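(* Let $\mathcal{L}$ be a principally generated $C$-lattice domain. The following are equivalent. (1) $\mathcal{L}$ is a radical factorial lattice, i.e. every element of $\mathcal{L}$ is a product of $\ell$-radical elements. (2) $\dim\mathcal{L}\leq 1$ and each $\ell$-invertible element is a product of $\ell$-radical elements. (3) Each nonzero $\ell$-prime element is maximal and is above (i.e. $\geq$) an $\ell$-invertible $\ell$-radical element. (4) Each element is a product of $\ell$-radical elements $x_1,\ldots,x_n$ with $x_1\leq\cdots\leq x_n$. (5) For each nonzero compact element $x$, the element $\sqrt{x}$ is $\ell$-invertible. (6) Every nonzero compact element is $\ell$-invertible, and $\sqrt{x}$ is compact for every compact element $x$.
   Context: A multiplicative lattice is a commutative monoid $\mathcal{L}$ with more than one element, with a partial order $\leq$ making it a complete lattice with top element $1$ and bottom element $0$, such that $1$ is the multiplicative identity and $x(\bigvee_{y\in S}y)=\bigvee_{y\in S}xy$ for all $x\in\mathcal{L}$, $S\subseteq\mathcal{L}$. It is a multiplicative lattice domain if $ab=0$ implies $a=0$ or $b=0$. An element $x$ is compact if $x\leq\bigvee_\alpha y_\alpha$ implies $x\leq y_{\alpha_1}\vee\cdots\vee y_{\alpha_n}$ for finitely many indices. $\mathcal{L}$ is a $C$-lattice if $1$ is compact, products of two compact elements are compact, and every element is a join of compact elements. A $C$-lattice domain is a $C$-lattice that is a multiplicative lattice domain. Put $(y:x)=\bigvee\{a\mid ax\leq y\}$ and $\sqrt{x}=\bigvee\{y\mid y^n\leq x\text{ for some }n\geq 1\}$. An element $x$ is $\ell$-radical if $x=\sqrt{x}$;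 it is $\ell$-prime if $x\neq 1$ and $ab\leq x$ implies $a\leq x$ or $b\leq x$; it is maximal if it is maximal among elements $\neq 1$. An element $x$ is meet principal if $y\wedge zx=((y:x)\wedge z)x$ for all $y,z$; join principal if $y\vee(z:x)=((yx\vee z):x)$ for all $y,z$; $\ell$-principal if it is both meet and join principal; cancellative if $xy=xz$ implies $y=z$; $\ell$-invertible if it is $\ell$-principal and cancellative. $\mathcal{L}$ is principally generated if each element is a join of $\ell$-principal elements. If the longest chain of $\ell$-prime elements has $n$ members, then $\dim\mathcal{L}=n-1$. Products are finite. *)

theory Defs
  imports Main "HOL-Library.Extended_Nat"
begin

text \<open>
  A multiplicative lattice is a type carrying both a complete lattice and a commutative monoid
  structure. The paper's elements 0 and 1 are \<^const>\<open>bot\<close> and \<open>1 = top\<close>.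
\<close>

class multiplicative_lattice = complete_lattice + comm_monoid_mult +
  assumes more_than_one_element: "\<exists>x y. x \<noteq> y"
    and one_eq_top: "1 = top"
    and mult_Sup_distrib: "x * Sup S = (SUP y\<in>S. x * y)"

class multiplicative_lattice_domain = multiplicative_lattice +
  assumes mult_eq_bot_imp: "a * b = bot \<Longrightarrow> a = bot \<or> b = bot"

definition (in complete_lattice) compact_element :: "'a \<Rightarrow> bool" where
  "compact_element x \<longleftrightarrow> (\<forall>Y. x \<le> Sup Y \<longrightarrow> (\<exists>F. finite F \<and> F \<subseteq> Y \<and> x \<le> Sup F))"

class c_lattice = multiplicative_lattice +
  assumes compact_one: "compact_element 1"
    and compact_mult: "compact_element x \<Longrightarrow> compact_element y \<Longrightarrow> compact_element (x * y)"
    and compactly_generated: "\<exists>S. (\<forall>s\<in>S. compact_element s) \<and> x = Sup S"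

class c_lattice_domain = c_lattice + multiplicative_lattice_domain

context multiplicative_lattice
begin

text \<open>\<open>residual y x\<close> is $(y : x)$.\<close>

definition residual :: "'a \<Rightarrow> 'a \<Rightarrow> 'a" where
  "residual y x = Sup {a. a * x \<le> y}"

definition radical :: "'a \<Rightarrow> 'a" where
  "radical x = Sup {y. \<exists>n\<ge>1. y ^ n \<le> x}"

definition l_radical :: "'a \<Rightarrow> bool" where
  "l_radical x \<longleftrightarrow> x = radical x"

definition l_prime :: "'a \<Rightarrow> bool" where
  "l_prime x \<longleftrightarrow> x \<noteq> 1 \<and> (\<forall>a b. a * b \<le> x \<longrightarrow> a \<le> x \<or> b \<le> x)"

definition maximal_element :: "'a \<Rightarrow> bool" where
  "maximal_element x \<longleftrightarrow> x \<noteq> 1 \<and> (\<forall>y. y \<noteq> 1 \<longrightarrow> x \<le> y \<longrightarrow> y = x)"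

definition meet_principal :: "'a \<Rightarrow> bool" where
  "meet_principal x \<longleftrightarrow> (\<forall>y z. inf y (z * x) = inf (residual y x) z * x)"

definition join_principal :: "'a \<Rightarrow> bool" where
  "join_principal x \<longleftrightarrow> (\<forall>y z. sup y (residual z x) = residual (sup (y * x) z) x)"

definition l_principal :: "'a \<Rightarrow> bool" where
  "l_principal x \<longleftrightarrow> meet_principal x \<and> join_principal x"

definition cancellative :: "'a \<Rightarrow> bool" where
  "cancellative x \<longleftrightarrow> (\<forall>y z. x * y = x * z \<longrightarrow> y = z)"

definition l_invertible :: "'a \<Rightarrow> bool" where
  "l_invertible x \<longleftrightarrow> l_principal x \<and> cancellative x"

text \<open>
  The empty product \<open>1\<close> is allowed here; as \<open>1\<close> is itself \<open>l_radical\<close>, requiring at least one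
  factor would give the same notion.
\<close>

definition product_of_l_radicals :: "'a \<Rightarrow> bool" where
  "product_of_l_radicals x \<longleftrightarrow> (\<exists>xs. (\<forall>y\<in>set xs. l_radical y) \<and> x = prod_list xs)"

end

class principally_generated = multiplicative_lattice +
  assumes principally_generated: "\<exists>S. (\<forall>s\<in>S. l_principal s) \<and> x = Sup S"

definition radical_factorial :: "'a::multiplicative_lattice itself \<Rightarrow> bool" where
  "radical_factorial L \<longleftrightarrow> (\<forall>x::'a. product_of_l_radicals x)"

text \<open>
  A supremum over finite chains, so that the dimension is \<open>\<infinity>\<close> when there is no longest chain.
  Chains are nonempty, so the subtraction does not truncate.
\<close>

definition lattice_dim :: "'a::multiplicative_lattice itself \<Rightarrow> enat" where
  "lattice_dim L = (SUP C \<in> {C :: 'a set. finite C \<and> C \<noteq> {} \<and>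
       (\<forall>p\<in>C. l_prime p) \<and> Complete_Partial_Order.chain (\<le>) C}. enat (card C - 1))"

end

theory Submission
  imports Defs
begin

text \<open>
  Suppose that every element is a product of \<open>\<ell>\<close>-radical elements and that \<open>p\<close> is a nonzero
  prime that is not maximal. Pick a principal \<open>y \<not>\<le> p\<close> that is not comaximal with \<open>p\<close>, and a
  prime \<open>q\<close> minimal over \<open>p \<or> y\<close>. If \<open>q\<close> is idempotent, then locally at \<open>q\<close> both \<open>p \<or> y\<close> and
  \<open>p \<or> y\<^sup>2\<close> are products of copies of \<open>q\<close>, hence equal, and cancelling \<open>y\<close> gives \<open>1 \<le> q\<close>. If
  there is a principal \<open>z \<le> q\<close> with \<open>z \<not>\<le> q\<^sup>2\<close>, then for each principal \<open>w \<le> q\<close> only one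
  factor of \<open>z \<or> w\<^sup>2\<close> lies below \<open>q\<close>; as it is radical, it lies above \<open>w\<close>, and so \<open>w \<le> z\<close>
  locally. Thus \<open>q\<close> is locally principal, so an invertible \<open>x \<le> p\<close> is locally divisible by
  \<open>z\<^sup>2\<close> and cannot be radical.

  Conversely, let the nonzero primes be maximal and above invertible radical elements \<open>x\<close>.
  Each such \<open>x\<close> generates the maximal elements above it locally, so that the lattice is locally
  a discrete valuation lattice; nonzero compact elements are then invertible and radicals of
  compact elements compact. Splitting off \<open>\<surd>c\<close> repeatedly factors a compact \<open>c\<close>, and as the
  splitting is monotone in \<open>c\<close>, it passes to directed joins, that is, to all elements.
\<close>

section \<open>Multiplicative lattices\<close>

lemma finite_Sup_closed:
  fixes F :: "'a::complete_lattice set"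
  assumes "finite F" "\<And>x. x \<in> F \<Longrightarrow> P x" "P bot" "\<And>x y. P x \<Longrightarrow> P y \<Longrightarrow> P (sup x y)"
  shows "P (Sup F)"
  using assms(1,2) by (induction F) (auto intro: assms(3,4))

lemma le_one: "(x::'a::multiplicative_lattice) \<le> 1"
  by (simp add: one_eq_top)

lemma one_le_iff: "1 \<le> (x::'a::multiplicative_lattice) \<longleftrightarrow> x = 1"
  using le_one antisym by blast

lemma mult_sup_distrib: "(x::'a::multiplicative_lattice) * sup y z = sup (x * y) (x * z)"
  using mult_Sup_distrib[of x "{y, z}"] by simp

lemma sup_mult_distrib: "sup y z * (x::'a::multiplicative_lattice) = sup (y * x) (z * x)"
  by (metis mult.commute mult_sup_distrib)

lemma mult_bot: "(x::'a::multiplicative_lattice) * bot = bot"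
  using mult_Sup_distrib[of x "{}"] by simp

lemma mult_left_mono_lattice: "y \<le> z \<Longrightarrow> (x::'a::multiplicative_lattice) * y \<le> x * z"
  by (metis mult_sup_distrib sup.absorb_iff2 sup.cobounded1)

lemma mult_mono_lattice:
  "a \<le> b \<Longrightarrow> c \<le> d \<Longrightarrow> (a::'a::multiplicative_lattice) * c \<le> b * d"
  by (metis mult.commute mult_left_mono_lattice order_trans)

lemma mult_le_left: "(a::'a::multiplicative_lattice) * b \<le> a"
  using mult_left_mono_lattice[OF le_one, of a b] by simp

lemma mult_le_right: "(a::'a::multiplicative_lattice) * b \<le> b"
  by (metis mult.commute mult_le_left)

lemma mult_le_left_trans: "a \<le> c \<Longrightarrow> (a::'a::multiplicative_lattice) * b \<le> c"
  using mult_le_left order_trans by blast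

lemma mult_le_right_trans: "b \<le> c \<Longrightarrow> (a::'a::multiplicative_lattice) * b \<le> c"
  using mult_le_right order_trans by blast

lemma power_mono_lattice: "a \<le> b \<Longrightarrow> (a::'a::multiplicative_lattice) ^ n \<le> b ^ n"
  by (induction n) (auto intro: mult_mono_lattice)

lemma prod_list_le_member:
  "x \<in> set xs \<Longrightarrow> prod_list xs \<le> (x::'a::multiplicative_lattice)"
  by (induction xs) (auto intro: mult_le_left mult_le_right_trans)

lemma one_neq_bot: "(1::'a::multiplicative_lattice) \<noteq> bot"
proof
  assume "(1::'a) = bot"
  then have "x = bot" for x :: 'a
    using le_one[of x] bot_unique by metis
  then show False
    using more_than_one_element by metis
qed

section \<open>Residuation and radicals\<close>

text \<open>Multiplication by \<open>x\<close> preserves joins, so the join defining the residual is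
  attained. Thus residuation is the right adjoint of multiplication.\<close>

lemma le_residual_iff: "a \<le> residual y x \<longleftrightarrow> (a::'a::multiplicative_lattice) * x \<le> y"
proof
  assume "a \<le> residual y x"
  then have "a * x \<le> x * Sup {a. a * x \<le> y}"
    unfolding residual_def by (metis mult.commute mult_left_mono_lattice)
  also have "\<dots> \<le> y"
    unfolding mult_Sup_distrib by (intro SUP_least) (simp add: mult.commute)
  finally show "a * x \<le> y" .
qed (auto simp: residual_def intro: Sup_upper)

lemma residual_mult_le: "residual y x * (x::'a::multiplicative_lattice) \<le> y"
  using le_residual_iff by blast

lemma le_residual: "(y::'a::multiplicative_lattice) \<le> residual y x"
  by (simp add: le_residual_iff mult_le_left)

lemma residual_eq_one_iff: "residual y x = 1 \<longleftrightarrow> (x::'a::multiplicative_lattice) \<le> y"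
  by (metis le_residual_iff mult_1 one_le_iff)

text \<open>Every term of the expanded power has at least \<open>n\<close> factors \<open>p\<close>
  or at least \<open>m\<close> factors \<open>q\<close>. Induction on \<open>n + m\<close> splits
  off one factor at a time, which avoids binomial sums.\<close>

lemma power_add_sup_le:
  "sup p q ^ (n + m) \<le> sup (p ^ n) ((q::'a::multiplicative_lattice) ^ m)"
proof (induction "n + m" arbitrary: n m)
  case 0
  then show ?case by simp
next
  case (Suc k)
  show ?case
  proof (cases "n = 0 \<or> m = 0")
    case True
    then show ?thesis by (auto simp: le_one sup.absorb1 sup.absorb2)
  next
    case False
    then obtain i j where ij: "n = Suc i" "m = Suc j"
      by (metis not0_implies_Suc)
    have "p * sup p q ^ (i + Suc j) \<le> p * sup (p ^ i) (q ^ Suc j)"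
      using Suc.hyps(1)[of i "Suc j"] Suc.hyps(2) ij
      by (intro mult_left_mono_lattice) (simp del: power_Suc)
    also have "\<dots> \<le> sup (p ^ n) (q ^ m)"
      by (simp add: mult_sup_distrib ij le_supI2 mult_le_right)
    finally have p: "p * sup p q ^ (i + Suc j) \<le> sup (p ^ n) (q ^ m)" .
    have "q * sup p q ^ (Suc i + j) \<le> q * sup (p ^ Suc i) (q ^ j)"
      using Suc.hyps(1)[of "Suc i" j] Suc.hyps(2) ij
      by (intro mult_left_mono_lattice) (simp del: power_Suc)
    also have "\<dots> \<le> sup (p ^ n) (q ^ m)"
      by (simp add: mult_sup_distrib ij le_supI1 mult_le_right)
    finally have q: "q * sup p q ^ (Suc i + j) \<le> sup (p ^ n) (q ^ m)" .
    show ?thesis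
      using p q by (simp add: ij sup_mult_distrib)
  qed
qed

lemma le_radical: "(x::'a::multiplicative_lattice) \<le> radical x"
  unfolding radical_def by (rule Sup_upper) (auto intro: exI[of _ 1])

lemma radical_mono: "(x::'a::multiplicative_lattice) \<le> y \<Longrightarrow> radical x \<le> radical y"
  unfolding radical_def by (intro Sup_subset_mono) (auto intro: order_trans)

lemma l_radical_power_le:
  assumes "l_radical r" "(q::'a::multiplicative_lattice) ^ n \<le> r"
  shows "q \<le> r"
proof (cases "n = 0")
  case True
  then show ?thesis using assms(2) le_one order_trans by fastforce
next
  case False
  then have "q \<le> radical r"
    using assms(2) unfolding radical_def by (intro Sup_upper) (auto simp: Suc_le_eq)
  then show ?thesis using assms(1) by (simp add: l_radical_def)
qed

section \<open>Primes against powers, products and radicals\<close>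

lemma l_prime_mult: "l_prime p \<Longrightarrow> a * b \<le> p \<Longrightarrow> a \<le> p \<or> (b::'a::multiplicative_lattice) \<le> p"
  by (simp add: l_prime_def)

lemma l_prime_power_le:
  assumes "l_prime p" "(q::'a::multiplicative_lattice) ^ n \<le> p"
  shows "q \<le> p"
  using assms(2)
proof (induction n)
  case 0
  then show ?case using assms(1) one_le_iff by (auto simp: l_prime_def)
qed (use l_prime_mult[OF assms(1)] in auto)

lemma l_prime_prod_list_le:
  assumes "l_prime p" "prod_list xs \<le> (p::'a::multiplicative_lattice)"
  shows "\<exists>x\<in>set xs. x \<le> p"
  using assms(2)
proof (induction xs)
  case Nil
  then show ?case using assms(1) one_le_iff by (auto simp: l_prime_def)
qed (use l_prime_mult[OF assms(1)] in auto)

lemma l_prime_radical_le_iff: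
  assumes "l_prime p"
  shows "radical x \<le> p \<longleftrightarrow> (x::'a::multiplicative_lattice) \<le> p"
proof
  assume "radical x \<le> p"
  with le_radical show "x \<le> p" by (rule order_trans)
next
  assume x: "x \<le> p"
  have "y \<le> p" if "y ^ n \<le> x" for y n
    using that x by (intro l_prime_power_le[OF assms, of y n]) (rule order_trans)
  then show "radical x \<le> p"
    unfolding radical_def by (intro Sup_least) blast
qed

lemma maximal_element_is_l_prime:
  assumes "maximal_element (m::'a::multiplicative_lattice)"
  shows "l_prime m"
  unfolding l_prime_def
proof (intro conjI allI impI)
  show "m \<noteq> 1" using assms by (simp add: maximal_element_def)
  fix a b assume ab: "a * b \<le> m"
  show "a \<le> m \<or> b \<le> m"
  proof (rule ccontr)
    assume n: "\<not> ?thesis"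
    have "sup m a = 1" "sup m b = 1"
      using assms n unfolding maximal_element_def by (metis sup.cobounded1 sup.orderI)+
    then have "1 = sup m a * sup m b" by simp
    also have "\<dots> \<le> m"
      by (simp add: mult_sup_distrib sup_mult_distrib ab mult_le_left mult_le_right)
    finally show False
      using assms one_le_iff by (auto simp: maximal_element_def)
  qed
qed

lemma maximal_element_l_prime_eq:
  "maximal_element p \<Longrightarrow> l_prime q \<Longrightarrow> p \<le> q \<Longrightarrow> (q::'a::multiplicative_lattice) = p"
  by (simp add: maximal_element_def l_prime_def)

lemma l_prime_bot: "l_prime (bot::'a::multiplicative_lattice_domain)"
  unfolding l_prime_def using one_neq_bot mult_eq_bot_imp bot_unique by metis

lemma l_radical_bot: "l_radical (bot::'a::multiplicative_lattice_domain)"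
  using l_prime_radical_le_iff[OF l_prime_bot, of "bot::'a"]
  by (simp add: l_radical_def bot_unique)

section \<open>Compact elements\<close>

lemma compact_bot: "compact_element (bot::'a::complete_lattice)"
  unfolding compact_element_def by (auto intro: exI[of _ "{}"])

lemma compact_sup:
  assumes "compact_element x" "compact_element (y::'a::complete_lattice)"
  shows "compact_element (sup x y)"
  unfolding compact_element_def
proof (intro allI impI)
  fix Y assume "sup x y \<le> Sup Y"
  then obtain F G where "finite F" "F \<subseteq> Y" "x \<le> Sup F" "finite G" "G \<subseteq> Y" "y \<le> Sup G"
    using assms unfolding compact_element_def by (metis le_sup_iff)
  then show "\<exists>F. finite F \<and> F \<subseteq> Y \<and> sup x y \<le> Sup F"
    by (intro exI[of _ "F \<union> G"]) (auto simp: Sup_union_distrib intro: le_supI1 le_supI2)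
qed

lemma compact_Sup:
  "finite F \<Longrightarrow> (\<And>x. x \<in> F \<Longrightarrow> compact_element x) \<Longrightarrow> compact_element (Sup F :: 'a::complete_lattice)"
  by (rule finite_Sup_closed) (auto intro: compact_bot compact_sup)

lemma compact_power: "compact_element x \<Longrightarrow> compact_element ((x::'a::c_lattice) ^ n)"
  by (induction n) (auto intro: compact_one compact_mult)

lemma compact_below:
  assumes "\<not> a \<le> (b::'a::c_lattice)"
  obtains c where "compact_element c" "c \<le> a" "\<not> c \<le> b"
  using assms compactly_generated[of a] by (metis Sup_least Sup_upper)

lemma le_by_compact:
  "(\<And>c. compact_element c \<Longrightarrow> c \<le> a \<Longrightarrow> c \<le> b) \<Longrightarrow> a \<le> (b::'a::c_lattice)"
  using compact_below by metis

lemma compact_le_Sup_directed: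
  fixes c :: "'a::complete_lattice"
  assumes "compact_element c" "c \<le> Sup D" "D \<noteq> {}"
    and "\<And>x y. x \<in> D \<Longrightarrow> y \<in> D \<Longrightarrow> \<exists>z\<in>D. sup x y \<le> z"
  obtains d where "d \<in> D" "c \<le> d"
proof -
  obtain F where F: "finite F" "F \<subseteq> D" "c \<le> Sup F"
    using assms(1,2) unfolding compact_element_def by blast
  have "\<exists>d\<in>D. Sup F \<le> d"
    using F(1,2)
  proof (induction F)
    case empty
    then show ?case using assms(3) by auto
  next
    case (insert x F)
    then obtain d where d: "d \<in> D" "Sup F \<le> d" by auto
    obtain z where z: "z \<in> D" "sup x d \<le> z" using assms(4)[of x d] insert.prems d(1) by auto
    have "Sup (insert x F) \<le> sup x d" using d(2) by (simp add: le_supI2)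
    then show ?case using z by (blast intro: order_trans)
  qed
  then show thesis using F(3) that order_trans by blast
qed

text \<open>Since \<open>a\<close> and \<open>b\<close> are joins of compact elements,
  \<open>a * b\<close> lies below the join of the products \<open>u * v\<close>. These form a
  directed set, so a single one lies above \<open>c\<close>.\<close>

lemma compact_le_mult:
  fixes c :: "'a::c_lattice"
  assumes "compact_element c" "c \<le> a * b"
  obtains u v where "compact_element u" "compact_element v" "u \<le> a" "v \<le> b" "c \<le> u * v"
proof -
  let ?D = "{u * v | u v. compact_element u \<and> compact_element v \<and> u \<le> a \<and> v \<le> b}"
  obtain A B where A: "\<forall>s\<in>A. compact_element s" "a = Sup A"
    and B: "\<forall>s\<in>B. compact_element s" "b = Sup B"
    using compactly_generated by meson
  have "u * b \<le> Sup ?D" if "u \<in> A" for u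
    unfolding B(2) mult_Sup_distrib using that A B
    by (intro SUP_least Sup_upper) (auto intro!: exI Sup_upper)
  then have "a * b \<le> Sup ?D"
    by (subst mult.commute, subst A(2), subst mult_Sup_distrib)
      (auto intro!: SUP_least simp: mult.commute)
  then have le: "c \<le> Sup ?D" using assms(2) by (rule order_trans[rotated])
  have dir: "\<exists>z\<in>?D. sup x y \<le> z" if xy: "x \<in> ?D" "y \<in> ?D" for x y
  proof -
    obtain u v u' v' where *: "x = u * v" "y = u' * v'" "compact_element u" "compact_element v"
      "compact_element u'" "compact_element v'" "u \<le> a" "v \<le> b" "u' \<le> a" "v' \<le> b"
      using xy by blast
    have "sup u u' * sup v v' \<in> ?D"
      using * compact_sup by (metis (mono_tags, lifting) le_supI mem_Collect_eq)
    moreover have "sup x y \<le> sup u u' * sup v v'"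
      unfolding * by (intro le_supI mult_mono_lattice) auto
    ultimately show ?thesis by blast
  qed
  have "bot * bot \<in> ?D"
    by (intro CollectI exI[of _ bot] conjI) (auto intro: compact_bot)
  then obtain d where "d \<in> ?D" "c \<le> d"
    using compact_le_Sup_directed[OF assms(1) le _ dir] by blast
  then show thesis using that by blast
qed

text \<open>By \<open>power_add_sup_le\<close> the elements having a power below \<open>x\<close>
  form a directed set, so a compact element below their join lies below one of them.\<close>

lemma compact_le_radical_iff:
  assumes "compact_element (q::'a::c_lattice)"
  shows "q \<le> radical x \<longleftrightarrow> (\<exists>n\<ge>1. q ^ n \<le> x)"
proof
  assume "q \<le> radical x"
  then have le: "q \<le> Sup {y. \<exists>n\<ge>1. y ^ n \<le> x}"
    by (simp add: radical_def)
  have dir: "\<exists>z\<in>{y. \<exists>n\<ge>1. y ^ n \<le> x}. sup u v \<le> z"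
    if "u \<in> {y. \<exists>n\<ge>1. y ^ n \<le> x}" "v \<in> {y. \<exists>n\<ge>1. y ^ n \<le> x}" for u v
  proof -
    obtain n m where nm: "n \<ge> 1" "u ^ n \<le> x" "m \<ge> 1" "v ^ m \<le> x" using \<open>u \<in> _\<close> \<open>v \<in> _\<close> by blast
    then have "sup u v ^ (n + m) \<le> x"
      using power_add_sup_le[of u v n m] by (meson le_supI order_trans)
    with nm show ?thesis by (intro bexI[of _ "sup u v"]) (auto intro!: exI[of _ "n + m"])
  qed
  have ne: "x \<in> {y. \<exists>n\<ge>1. y ^ n \<le> x}" by (auto intro: exI[of _ 1])
  obtain d where d: "d \<in> {y. \<exists>n\<ge>1. y ^ n \<le> x}" "q \<le> d"
    by (rule compact_le_Sup_directed[OF assms le _ dir]) (use ne in blast)+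
  then show "\<exists>n\<ge>1. q ^ n \<le> x" using power_mono_lattice order_trans by blast
next
  assume "\<exists>n\<ge>1. q ^ n \<le> x"
  then show "q \<le> radical x" unfolding radical_def by (auto intro: Sup_upper)
qed

lemma l_radical_radical: "l_radical (radical (x::'a::c_lattice))"
  unfolding l_radical_def
proof (rule antisym[OF le_radical le_by_compact])
  fix q assume q: "compact_element q" "q \<le> radical (radical x)"
  then obtain n where n: "n \<ge> 1" "q ^ n \<le> radical x" using compact_le_radical_iff by blast
  then obtain m where "m \<ge> 1" "(q ^ n) ^ m \<le> x"
    using compact_le_radical_iff[OF compact_power[OF q(1)]] by blast
  then show "q \<le> radical x"
    using n(1) compact_le_radical_iff[OF q(1)] by (metis nat_0_less_mult_iff One_nat_def Suc_le_eq power_mult)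
qed

lemma l_radicalI:
  assumes "\<And>q n. compact_element q \<Longrightarrow> q ^ n \<le> r \<Longrightarrow> q \<le> (r::'a::c_lattice)"
  shows "l_radical r"
  unfolding l_radical_def
  by (rule antisym[OF le_radical le_by_compact]) (use assms compact_le_radical_iff in blast)

section \<open>Prime elements\<close>

text \<open>Krull's separation argument. Compactness of the members of \<open>S\<close> lets joins
  of chains avoid \<open>S\<close>, so Zorn's lemma applies. The last conclusion records maximality;
  for \<open>S = {1}\<close> it yields maximal elements.\<close>

lemma l_prime_above_avoiding:
  fixes a :: "'a::c_lattice"
  assumes compact: "\<And>s. s \<in> S \<Longrightarrow> compact_element s"
    and "1 \<in> S" and mult: "\<And>s t. s \<in> S \<Longrightarrow> t \<in> S \<Longrightarrow> s * t \<in> S"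
    and a: "\<And>s. s \<in> S \<Longrightarrow> \<not> s \<le> a"
  obtains p where "l_prime p" "a \<le> p" "\<And>s. s \<in> S \<Longrightarrow> \<not> s \<le> p"
    "\<And>b. p \<le> b \<Longrightarrow> (\<And>s. s \<in> S \<Longrightarrow> \<not> s \<le> b) \<Longrightarrow> b = p"
proof -
  define F where "F = {b. a \<le> b \<and> (\<forall>s\<in>S. \<not> s \<le> b)}"
  have "\<exists>u\<in>F. \<forall>b\<in>C. b \<le> u" if C: "C \<in> Chains (relation_of (\<le>) F)" for C
  proof (cases "C = {}")
    case True
    then show ?thesis using a unfolding F_def by blast
  next
    case False
    have CF: "C \<subseteq> F" and tot: "\<And>x y. x \<in> C \<Longrightarrow> y \<in> C \<Longrightarrow> x \<le> y \<or> y \<le> x"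
      using C unfolding Chains_def relation_of_def by blast+
    have dir: "\<And>x y. x \<in> C \<Longrightarrow> y \<in> C \<Longrightarrow> \<exists>z\<in>C. sup x y \<le> z"
      using tot by (metis le_supI order_refl)
    have "\<not> s \<le> Sup C" if s: "s \<in> S" for s
    proof
      assume "s \<le> Sup C"
      then obtain d where "d \<in> C" "s \<le> d"
        using compact_le_Sup_directed[OF compact[OF s] _ False dir] by blast
      then show False using CF s unfolding F_def by blast
    qed
    moreover have "a \<le> Sup C"
      using False CF unfolding F_def by (metis (no_types, lifting) Sup_upper2 equals0I mem_Collect_eq subsetD)
    ultimately have "Sup C \<in> F" unfolding F_def by blast
    then show ?thesis using Sup_upper by blast
  qed
  then obtain p where p: "p \<in> F" and max: "\<And>b. b \<in> F \<Longrightarrow> p \<le> b \<Longrightarrow> b = p"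
    using predicate_Zorn[of F "(\<le>)"] partial_order_on_relation_ofI[of F "(\<le>)"]
    by (smt (verit) antisym order_refl order_trans)
  have ap: "a \<le> p" and av: "\<And>s. s \<in> S \<Longrightarrow> \<not> s \<le> p" using p unfolding F_def by auto
  \<comment> \<open>Primality follows from this: if neither \<open>u\<close> nor \<open>v\<close> is
    below \<open>p\<close> but \<open>u * v\<close> is, then the product of the two members of
    \<open>S\<close> found here is below \<open>p\<close>.\<close>
  have hit: "\<exists>s\<in>S. s \<le> sup p u" if "\<not> u \<le> p" for u
  proof (rule ccontr)
    assume "\<not> ?thesis"
    then have "sup p u \<in> F" using ap le_supI1 unfolding F_def by blast
    then have "sup p u = p" using max by simp
    then show False using that by (metis sup.cobounded2)
  qed
  have "l_prime p"
    unfolding l_prime_def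
  proof (intro conjI allI impI)
    show "p \<noteq> 1" using av[OF \<open>1 \<in> S\<close>] by auto
    fix u v assume uv: "u * v \<le> p"
    show "u \<le> p \<or> v \<le> p"
    proof (rule ccontr)
      assume "\<not> ?thesis"
      then obtain s t where st: "s \<in> S" "t \<in> S" "s \<le> sup p u" "t \<le> sup p v" using hit by metis
      have "s * t \<le> sup p u * sup p v" using st mult_mono_lattice by blast
      also have "\<dots> \<le> p"
        by (simp add: mult_sup_distrib sup_mult_distrib uv mult_le_left mult_le_right)
      finally show False using av mult st by blast
    qed
  qed
  moreover have "b = p" if b: "p \<le> b" "\<And>s. s \<in> S \<Longrightarrow> \<not> s \<le> b" for b
    using max[of b] b order_trans[OF ap b(1)] unfolding F_def by blast
  ultimately show thesis using that[of p] ap av by blast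
qed

lemma maximal_element_above:
  assumes "(a::'a::c_lattice) \<noteq> 1"
  obtains m where "maximal_element m" "a \<le> m"
proof -
  obtain p where p: "l_prime p" "a \<le> p" "\<And>b. p \<le> b \<Longrightarrow> (\<And>s. s \<in> {1} \<Longrightarrow> \<not> s \<le> b) \<Longrightarrow> b = p"
    by (rule l_prime_above_avoiding[of "{1}" a])
      (use assms compact_one in \<open>auto simp: one_le_iff\<close>)
  have "maximal_element p"
    using p(1) p(3) unfolding maximal_element_def l_prime_def by (auto simp: one_le_iff)
  then show thesis using that p(2) by blast
qed

text \<open>Zorn's lemma for the reversed order: the meet of a nonempty chain of primes is prime,
  because two failures can be tested at the smaller of two members of the chain.\<close>

lemma minimal_l_prime_below:
  fixes m :: "'a::multiplicative_lattice"
  assumes "l_prime m" "a \<le> m"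
  obtains q where "l_prime q" "a \<le> q" "q \<le> m"
    "\<And>p. l_prime p \<Longrightarrow> a \<le> p \<Longrightarrow> p \<le> q \<Longrightarrow> p = q"
proof -
  define F where "F = {b. l_prime b \<and> a \<le> b \<and> b \<le> m}"
  have "\<exists>u\<in>F. \<forall>b\<in>C. b \<ge> u" if C: "C \<in> Chains (relation_of (\<ge>) F)" for C
  proof (cases "C = {}")
    case True
    then show ?thesis using assms unfolding F_def by blast
  next
    case False
    then obtain c where c: "c \<in> C" by blast
    have CF: "C \<subseteq> F" and tot: "\<And>x y. x \<in> C \<Longrightarrow> y \<in> C \<Longrightarrow> x \<le> y \<or> y \<le> x"
      using C unfolding Chains_def relation_of_def by blast+
    have "l_prime (Inf C)"
      unfolding l_prime_def
    proof (intro conjI allI impI)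
      show "Inf C \<noteq> 1"
      proof -
        have "c \<noteq> 1" using c CF unfolding F_def l_prime_def by auto
        then show ?thesis using Inf_lower[OF c] one_le_iff by metis
      qed
      fix u v assume uv: "u * v \<le> Inf C"
      show "u \<le> Inf C \<or> v \<le> Inf C"
      proof (rule ccontr)
        assume "\<not> ?thesis"
        then obtain x y where xy: "x \<in> C" "\<not> u \<le> x" "y \<in> C" "\<not> v \<le> y" by (meson Inf_greatest)
        then obtain z where z: "z \<in> C" "z \<le> x" "z \<le> y" using tot by blast
        have "u * v \<le> z" using uv Inf_lower[OF z(1)] by (rule order_trans)
        then have "u \<le> z \<or> v \<le> z" using z(1) CF unfolding F_def l_prime_def by blast
        then show False using xy z order_trans by blast
      qed
    qed
    moreover have "a \<le> Inf C" using CF unfolding F_def by (auto intro: Inf_greatest)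
    moreover have "Inf C \<le> m" using c CF unfolding F_def by (auto intro: Inf_lower2)
    ultimately have "Inf C \<in> F" unfolding F_def by blast
    then show ?thesis using Inf_lower by blast
  qed
  then obtain q where q: "q \<in> F" and min: "\<And>b. b \<in> F \<Longrightarrow> q \<ge> b \<Longrightarrow> b = q"
    using predicate_Zorn[of F "(\<ge>)"] partial_order_on_relation_ofI[of F "(\<ge>)"]
    by (smt (verit) antisym order_refl order_trans)
  have qm: "l_prime q" "a \<le> q" "q \<le> m" using q unfolding F_def by auto
  moreover have "p = q" if p: "l_prime p" "a \<le> p" "p \<le> q" for p
    using min[of p] p order_trans[OF p(3) qm(3)] unfolding F_def by blast
  ultimately show thesis by (rule that)
qed

text \<open>Locally at a minimal prime \<open>q\<close> over \<open>a\<close>, every compact element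
  below \<open>q\<close> is nilpotent modulo \<open>a\<close>. Otherwise the products
  \<open>s * c ^ n\<close> are a multiplicative set that a prime above \<open>a\<close>
  avoids.\<close>

lemma minimal_l_prime_power_le:
  fixes q :: "'a::c_lattice"
  assumes "l_prime q" "a \<le> q" and min: "\<And>p. l_prime p \<Longrightarrow> a \<le> p \<Longrightarrow> p \<le> q \<Longrightarrow> p = q"
    and c: "compact_element c" "c \<le> q"
  shows "\<exists>s n. \<not> s \<le> q \<and> s * c ^ n \<le> a"
proof (rule ccontr)
  assume n: "\<not> ?thesis"
  define S where "S = {s * c ^ n | s n. compact_element s \<and> \<not> s \<le> q}"
  have one: "\<not> 1 \<le> q" using assms(1) one_le_iff by (auto simp: l_prime_def)
  have S: "s * c ^ n \<in> S" if "compact_element s" "\<not> s \<le> q" for s n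
    using that unfolding S_def by blast
  have mult: "s * t \<in> S" if st: "s \<in> S" "t \<in> S" for s t
  proof -
    obtain u n v m where "s = u * c ^ n" "t = v * c ^ m" "compact_element u" "\<not> u \<le> q"
      "compact_element v" "\<not> v \<le> q" using st unfolding S_def by blast
    moreover from this have "s * t = (u * v) * c ^ (n + m)" by (simp add: power_add ac_simps)
    ultimately show ?thesis using S compact_mult l_prime_mult[OF assms(1)] by metis
  qed
  obtain p where p: "l_prime p" "a \<le> p" "\<And>s. s \<in> S \<Longrightarrow> \<not> s \<le> p"
  proof (rule l_prime_above_avoiding[of S a])
    show "1 \<in> S" using S[OF compact_one one, of 0] by simp
    show "compact_element s" if "s \<in> S" for s
      using that c(1) compact_mult compact_power unfolding S_def by blast
    show "\<not> s \<le> a" if "s \<in> S" for s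
      using that n unfolding S_def by blast
  qed (use mult in blast)+
  \<comment> \<open>Exponent 0 puts every compact element not below \<open>q\<close> into
    \<open>S\<close>. Minimality then forces \<open>p = q\<close>, although \<open>c\<close> itself
    is in \<open>S\<close>.\<close>
  have "p \<le> q"
  proof (rule ccontr)
    assume "\<not> p \<le> q"
    then obtain s where "compact_element s" "s \<le> p" "\<not> s \<le> q" using compact_below by blast
    then show False using p(3) S[of s 0] by simp
  qed
  then have "p = q" using min p by blast
  then show False using p(3) S[OF compact_one one, of 1] c(2) by simp
qed

text \<open>From \<open>s * c ^ n \<le> r\<close> follows \<open>(s * c) ^ Suc n \<le> r\<close>,
  and the exponent is removed because \<open>r\<close> is radical. \<open>Suc\<close> ensures a
  factor \<open>s\<close> even for \<open>n = 0\<close>.\<close>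

lemma minimal_l_prime_l_radical:
  fixes q :: "'a::c_lattice"
  assumes "l_prime q" "r \<le> q" "\<And>p. l_prime p \<Longrightarrow> r \<le> p \<Longrightarrow> p \<le> q \<Longrightarrow> p = q"
    and "l_radical r" "compact_element c" "c \<le> q"
  shows "\<exists>s. \<not> s \<le> q \<and> s * c \<le> r"
proof -
  obtain s n where s: "\<not> s \<le> q" "s * c ^ n \<le> r"
    using minimal_l_prime_power_le[OF assms(1-3,5,6)] by blast
  have "(s * c) ^ Suc n \<le> s * c ^ n"
    unfolding power_mult_distrib
    by (intro mult_mono_lattice) (auto intro: mult_le_left mult_le_right)
  then have "(s * c) ^ Suc n \<le> r" using s(2) by (rule order_trans)
  then show ?thesis using s(1) l_radical_power_le[OF assms(4)] by blast
qed

text \<open>The hypothesis says that \<open>a \<le> b\<close> holds locally at each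
  \<open>m\<close>. It means that the residual of \<open>b\<close> by \<open>a\<close> is below no
  maximal element, so this residual is \<open>1\<close>.\<close>

lemma le_by_localization:
  fixes a b :: "'a::c_lattice"
  assumes "\<And>m. maximal_element m \<Longrightarrow> \<exists>s. \<not> s \<le> m \<and> s * a \<le> b"
  shows "a \<le> b"
proof (rule ccontr)
  assume "\<not> a \<le> b"
  then have "residual b a \<noteq> 1" by (simp add: residual_eq_one_iff)
  then obtain m where m: "maximal_element m" "residual b a \<le> m" by (rule maximal_element_above)
  then show False using assms[OF m(1)] le_residual_iff order_trans by blast
qed

section \<open>Principal and invertible elements\<close>

lemma meet_principal_residual_mult:
  assumes "meet_principal x" "z \<le> (x::'a::multiplicative_lattice)"
  shows "residual z x * x = z"
proof -
  have "inf z (1 * x) = inf (residual z x) 1 * x"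
    using assms(1) unfolding meet_principal_def by blast
  then show ?thesis using assms(2) by (simp add: inf.absorb1 le_one)
qed

text \<open>Write \<open>x\<close> as a join of compact elements \<open>s\<close>. Each
  \<open>s\<close> is \<open>x\<close> times its residual by \<open>x\<close>, so
  \<open>x = w * x\<close> for the join \<open>w\<close> of these residuals. Compactness of
  \<open>1\<close> cuts \<open>w\<close> down to a finite join.\<close>

lemma l_principal_compact:
  assumes "l_principal (x::'a::c_lattice)"
  shows "compact_element x"
proof -
  have meet: "meet_principal x" and join: "join_principal x"
    using assms by (auto simp: l_principal_def)
  obtain S where S: "\<forall>s\<in>S. compact_element s" "x = Sup S" using compactly_generated by blast
  define w where "w = (SUP s\<in>S. residual s x)"
  have "x * w = (SUP s\<in>S. x * residual s x)"
    unfolding w_def mult_Sup_distrib by (simp add: image_image)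
  also have "\<dots> = (SUP s\<in>S. s)"
    using meet_principal_residual_mult[OF meet] S(2) Sup_upper
    by (intro SUP_cong) (auto simp: mult.commute)
  finally have wx: "w * x = x" using S(2) by (simp add: mult.commute)
  \<comment> \<open>Join principality cancels \<open>x\<close> from \<open>w * x = x\<close> up to
    the annihilator of \<open>x\<close>, which contributes only \<open>bot\<close> after
    multiplication by \<open>x\<close>.\<close>
  have "sup w (residual bot x) = residual (sup (w * x) bot) x"
    using join unfolding join_principal_def by blast
  also have "\<dots> = 1" by (simp add: wx residual_eq_one_iff)
  finally have "1 \<le> Sup (insert (residual bot x) ((\<lambda>s. residual s x) ` S))"
    by (simp add: w_def sup.commute)
  then obtain F where F: "finite F" "F \<subseteq> insert (residual bot x) ((\<lambda>s. residual s x) ` S)"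
    "1 \<le> Sup F"
    using compact_one unfolding compact_element_def by blast
  have "x = x * Sup F" using F(3) one_le_iff by (metis mult_1_right)
  also have "\<dots> = Sup ((\<lambda>v. x * v) ` F)" by (rule mult_Sup_distrib)
  finally have x: "x = Sup ((\<lambda>v. x * v) ` F)" .
  have "compact_element (x * v)" if v: "v \<in> F" for v
  proof (cases "v = residual bot x")
    case True
    then have "x * v = bot" using residual_mult_le[of bot x] by (simp add: bot_unique mult.commute)
    then show ?thesis by (simp add: compact_bot)
  next
    case False
    then obtain s where s: "s \<in> S" "v = residual s x" using v F(2) by auto
    have "s \<le> x" using S(2) s(1) Sup_upper by metis
    then have "x * v = s" using meet_principal_residual_mult[OF meet] s(2) by (simp add: mult.commute)
    then show ?thesis using S(1) s(1) by simp
  qed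
  then have "compact_element (Sup ((\<lambda>v. x * v) ` F))"
    using F(1) by (intro compact_Sup) auto
  then show ?thesis using x by simp
qed

lemma l_invertible_compact: "l_invertible x \<Longrightarrow> compact_element (x::'a::c_lattice)"
  by (simp add: l_invertible_def l_principal_compact)

lemma l_invertible_neq_bot:
  assumes "l_invertible (x::'a::multiplicative_lattice)"
  shows "x \<noteq> bot"
proof
  assume "x = bot"
  then have "x * 1 = x * bot" by (simp add: mult_bot)
  then have "(1::'a) = bot" using assms unfolding l_invertible_def cancellative_def by blast
  then show False using one_neq_bot by blast
qed

lemma l_invertible_mult_le_cancel:
  assumes "l_invertible x" "x * y \<le> x * (z::'a::multiplicative_lattice)"
  shows "y \<le> z"
proof -
  have "x * sup y z = x * z" using assms(2) by (simp add: mult_sup_distrib sup.absorb2)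
  then have "sup y z = z" using assms(1) unfolding l_invertible_def cancellative_def by blast
  then show ?thesis by (simp add: le_iff_sup)
qed

lemma l_invertible_dvd:
  assumes "l_invertible x" "z \<le> (x::'a::multiplicative_lattice)"
  shows "\<exists>w. z = x * w"
proof -
  have "residual z x * x = z"
    using meet_principal_residual_mult[OF _ assms(2)] assms(1)
    by (simp add: l_invertible_def l_principal_def)
  then have "z = x * residual z x" by (simp add: mult.commute)
  then show ?thesis ..
qed

lemma l_invertible_join:
  assumes "l_invertible x" "a * x \<le> sup (y * x) (z::'a::multiplicative_lattice)"
  shows "a \<le> sup y (residual z x)"
  using assms le_residual_iff[of a "sup (y * x) z" x]
  by (simp add: l_invertible_def l_principal_def join_principal_def)

text \<open>The three assumptions are cancellation for inequalities, divisibility and the nontrivial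
  half of join principality. The first two together give meet principality.\<close>

lemma l_invertibleI:
  fixes x :: "'a::multiplicative_lattice"
  assumes cancel: "\<And>y z. x * y \<le> x * z \<Longrightarrow> y \<le> z"
    and dvd: "\<And>z. z \<le> x \<Longrightarrow> \<exists>w. z = x * w"
    and join: "\<And>a y z. a * x \<le> sup (y * x) z \<Longrightarrow> a \<le> sup y (residual z x)"
  shows "l_invertible x"
  unfolding l_invertible_def l_principal_def
proof (intro conjI)
  show "cancellative x"
    unfolding cancellative_def using cancel by (metis antisym order_refl)
  show "meet_principal x"
    unfolding meet_principal_def
  proof (intro allI antisym)
    fix y z
    show "inf (residual y x) z * x \<le> inf y (z * x)"
      by (rule le_infI) (simp flip: le_residual_iff, simp add: mult_mono_lattice)
    obtain w where w: "inf y (z * x) = x * w"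
      using dvd[of "inf y (z * x)"] mult_le_right le_infI2 by metis
    have "x * w \<le> y" "x * w \<le> x * z" using w by (metis inf_le1, metis inf_le2 mult.commute)
    then have "w \<le> inf (residual y x) z" using cancel by (simp add: le_residual_iff mult.commute)
    then show "inf y (z * x) \<le> inf (residual y x) z * x"
      unfolding w by (metis mult.commute mult_left_mono_lattice)
  qed
  show "join_principal x"
    unfolding join_principal_def
  proof (intro allI antisym)
    fix y z
    show "sup y (residual z x) \<le> residual (sup (y * x) z) x"
      by (simp add: le_residual_iff sup_mult_distrib le_supI2 residual_mult_le)
    show "residual (sup (y * x) z) x \<le> sup y (residual z x)"
      by (rule join) (rule residual_mult_le)
  qed
qed

section \<open>Products and factors of invertible elements\<close>

lemma l_invertible_mult:
  fixes x y :: "'a::multiplicative_lattice"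
  assumes x: "l_invertible x" and y: "l_invertible y"
  shows "l_invertible (x * y)"
proof (rule l_invertibleI)
  fix u v assume "x * y * u \<le> x * y * v"
  then have "x * (y * u) \<le> x * (y * v)" by (simp add: mult.assoc)
  then have "y * u \<le> y * v" by (rule l_invertible_mult_le_cancel[OF x])
  then show "u \<le> v" by (rule l_invertible_mult_le_cancel[OF y])
next
  fix z assume z: "z \<le> x * y"
  then obtain w where w: "z = x * w" using l_invertible_dvd[OF x] mult_le_left order_trans by blast
  then have "w \<le> y" using z l_invertible_mult_le_cancel[OF x] by blast
  then show "\<exists>w. z = x * y * w" using l_invertible_dvd[OF y] w by (metis mult.assoc)
next
  fix a u v assume "a * (x * y) \<le> sup (u * (x * y)) v"
  then have "a * x \<le> sup (u * x) (residual v y)"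
    by - (rule l_invertible_join[OF y], simp add: mult.assoc)
  then have "a \<le> sup u (residual (residual v y) x)" by (rule l_invertible_join[OF x])
  also have "residual (residual v y) x \<le> residual v (x * y)"
    using residual_mult_le[of "residual v y" x] by (simp add: le_residual_iff mult.assoc)
  finally show "a \<le> sup u (residual v (x * y))" by (simp add: sup.coboundedI2)
qed

text \<open>Each criterion for \<open>x\<close> is multiplied by \<open>y\<close>, answered by the
  invertibility of \<open>x * y\<close>, and then \<open>x * y\<close> is cancelled.\<close>

lemma l_invertible_factor:
  fixes x y :: "'a::multiplicative_lattice"
  assumes xy: "l_invertible (x * y)"
  shows "l_invertible x"
proof (rule l_invertibleI)
  fix u v assume "x * u \<le> x * v"
  then have "y * (x * u) \<le> y * (x * v)" by (rule mult_left_mono_lattice)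
  then show "u \<le> v" by - (rule l_invertible_mult_le_cancel[OF xy], simp add: ac_simps)
next
  fix z assume "z \<le> x"
  then have "z * y \<le> x * y" by (simp add: mult_mono_lattice)
  then obtain w where "z * y = x * y * w" using l_invertible_dvd[OF xy] by blast
  then have "x * y * z = x * y * (x * w)" by (metis mult.assoc mult.commute)
  then show "\<exists>w. z = x * w" using xy unfolding l_invertible_def cancellative_def by blast
next
  fix a u v assume "a * x \<le> sup (u * x) v"
  then have "a * x * y \<le> sup (u * x) v * y" by (simp add: mult_mono_lattice)
  then have "a * (x * y) \<le> sup (u * (x * y)) (v * y)" by (simp add: sup_mult_distrib mult.assoc)
  then have "a \<le> sup u (residual (v * y) (x * y))" by (rule l_invertible_join[OF xy])
  also have "residual (v * y) (x * y) \<le> residual v x"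
  proof -
    have "residual (v * y) (x * y) * (x * y) \<le> v * y" by (rule residual_mult_le)
    then have "x * (residual (v * y) (x * y) * (x * y)) \<le> x * (v * y)" by (rule mult_left_mono_lattice)
    then have "x * y * (residual (v * y) (x * y) * x) \<le> x * y * v" by (simp add: ac_simps)
    then show ?thesis unfolding le_residual_iff by (rule l_invertible_mult_le_cancel[OF xy])
  qed
  finally show "a \<le> sup u (residual v x)" by (simp add: sup.coboundedI2)
qed

lemma l_invertible_factor_right: "l_invertible (x * y) \<Longrightarrow> l_invertible (y::'a::multiplicative_lattice)"
  by (metis l_invertible_factor mult.commute)

lemma l_invertible_prod_list_factor:
  "l_invertible (prod_list xs) \<Longrightarrow> x \<in> set xs \<Longrightarrow> l_invertible (x::'a::multiplicative_lattice)"
  by (induction xs) (auto dest: l_invertible_factor l_invertible_factor_right)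

section \<open>Invertible elements in principally generated domains\<close>

text \<open>In a domain the annihilator of \<open>x\<close> is \<open>bot\<close>, so the join
  principal identity with \<open>z = bot\<close> says that dividing \<open>y * x\<close> by
  \<open>x\<close> returns \<open>y\<close>.\<close>

lemma l_principal_l_invertible:
  assumes "l_principal x" "(x::'a::multiplicative_lattice_domain) \<noteq> bot"
  shows "l_invertible x"
proof -
  have join: "join_principal x" using assms(1) by (simp add: l_principal_def)
  have "residual bot x = bot"
    using residual_mult_le[of bot x] mult_eq_bot_imp assms(2) bot_unique by metis
  then have "residual (y * x) x = y" for y
    using join unfolding join_principal_def by (metis sup_bot_right)
  then have "cancellative x"
    unfolding cancellative_def by (metis mult.commute)
  then show ?thesis using assms(1) by (simp add: l_invertible_def)
qed

lemma l_invertible_below: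
  fixes a b :: "'a::{multiplicative_lattice_domain, principally_generated}"
  assumes "\<not> a \<le> b"
  obtains c where "l_invertible c" "c \<le> a" "\<not> c \<le> b"
proof -
  obtain S where "\<forall>s\<in>S. l_principal s" "a = Sup S" using principally_generated by blast
  then obtain c where "l_principal c" "c \<le> a" "\<not> c \<le> b"
    using assms by (metis Sup_least Sup_upper)
  then show thesis using that l_principal_l_invertible by (metis bot_least)
qed

text \<open>A compact element is a finite join of principal elements, and the nonzero ones among
  these are invertible.\<close>

lemma compact_l_invertibleI:
  fixes c :: "'a::{multiplicative_lattice_domain, principally_generated}"
  assumes "compact_element c" "c \<noteq> bot"
    and sup: "\<And>x y. l_invertible x \<Longrightarrow> l_invertible y \<Longrightarrow> l_invertible (sup x y :: 'a)"
  shows "l_invertible c"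
proof -
  obtain S where S: "\<forall>s\<in>S. l_principal s" "c = Sup S" using principally_generated by blast
  then obtain F where F: "finite F" "F \<subseteq> S" "c \<le> Sup F"
    using assms(1) unfolding compact_element_def by blast
  have "c = Sup F" using F(3) Sup_subset_mono[OF F(2)] S(2) by (intro antisym) simp_all
  moreover have "Sup F = bot \<or> l_invertible (Sup F)"
    by (rule finite_Sup_closed[OF F(1)]) (use F(2) S(1) l_principal_l_invertible sup in auto)
  ultimately show ?thesis using assms(2) by blast
qed

section \<open>Factorization forces dimension at most one\<close>

text \<open>Factor an invertible element below \<open>p\<close>. Primality puts one factor below
  \<open>p\<close>, and factors of invertible elements are invertible.\<close>

lemma l_prime_above_l_invertible_l_radical:
  fixes p :: "'a::{multiplicative_lattice_domain, principally_generated}"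
  assumes "\<And>x::'a. l_invertible x \<Longrightarrow> product_of_l_radicals x" and p: "l_prime p" "p \<noteq> bot"
  obtains x where "l_invertible x" "l_radical x" "x \<le> p"
proof -
  obtain a where a: "l_invertible a" "a \<le> p"
    using l_invertible_below[of p bot] p(2) bot_unique by blast
  then obtain xs where xs: "\<forall>y\<in>set xs. l_radical y" "a = prod_list xs"
    using assms(1) unfolding product_of_l_radicals_def by blast
  then obtain x where "x \<in> set xs" "x \<le> p" using l_prime_prod_list_le[OF p(1)] a(2) by blast
  then show thesis using that xs a(1) l_invertible_prod_list_factor by blast
qed

text \<open>If at least two factors lie below \<open>q\<close>, the product lies below
  \<open>q * q\<close>. If exactly one does, the product of the others is not below \<open>q\<close>
  and serves as \<open>s\<close>.\<close>

lemma prod_list_le_l_prime_cases: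
  fixes q :: "'a::multiplicative_lattice"
  assumes q: "l_prime q" and "prod_list rs \<le> q"
  shows "prod_list rs \<le> q * q \<or> (\<exists>r\<in>set rs. \<exists>s. r \<le> q \<and> \<not> s \<le> q \<and> prod_list rs = s * r)"
  using assms(2)
proof (induction rs)
  case Nil
  then show ?case using q by (simp add: l_prime_def one_le_iff)
next
  case (Cons r rs)
  show ?case
  proof (cases "prod_list rs \<le> q")
    case False
    then have "r \<le> q" using Cons.prems l_prime_mult[OF q] by auto
    then show ?thesis using False by (auto simp: mult.commute)
  next
    case True
    show ?thesis
    proof (cases "r \<le> q")
      case True
      then show ?thesis using \<open>prod_list rs \<le> q\<close> by (simp add: mult_mono_lattice)
    next
      case False
      from Cons.IH[OF \<open>prod_list rs \<le> q\<close>] show ?thesis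
      proof (elim disjE bexE exE conjE)
        assume "prod_list rs \<le> q * q"
        then show ?thesis by (simp add: mult_le_right_trans)
      next
        fix r' s assume "r' \<in> set rs" "r' \<le> q" "\<not> s \<le> q" "prod_list rs = s * r'"
        moreover have "\<not> r * s \<le> q" using False \<open>\<not> s \<le> q\<close> l_prime_mult[OF q] by blast
        ultimately show ?thesis by (metis list.set_intros(2) mult.assoc prod_list.Cons)
      qed
    qed
  qed
qed

text \<open>Locally at an idempotent \<open>q\<close> that is minimal over each \<open>r\<close>, the product of the \<open>r\<close> is \<open>q\<close>.\<close>

lemma idempotent_l_prime_prod_list:
  fixes q :: "'a::c_lattice"
  assumes q: "l_prime q" "q \<le> q * q"
    and rs: "\<And>r c. r \<in> set rs \<Longrightarrow> compact_element c \<Longrightarrow> c \<le> q \<Longrightarrow> \<exists>s. \<not> s \<le> q \<and> s * c \<le> r"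
    and "compact_element c" "c \<le> q"
  shows "\<exists>s. \<not> s \<le> q \<and> s * c \<le> prod_list rs"
  using rs assms(4,5)
proof (induction rs arbitrary: c)
  case Nil
  have "\<not> 1 \<le> q" using q(1) by (simp add: l_prime_def one_le_iff)
  then show ?case using le_one by auto
next
  case (Cons r rs)
  \<comment> \<open>Idempotency of \<open>q\<close> splits \<open>c\<close> into a part for the head
    of the list and a part for its tail.\<close>
  obtain u v where uv: "compact_element u" "compact_element v" "u \<le> q" "v \<le> q" "c \<le> u * v"
    using compact_le_mult[of c q q] Cons.prems(2,3) q(2) order_trans by blast
  obtain s where s: "\<not> s \<le> q" "s * u \<le> r" using Cons.prems(1)[of r u] uv by auto
  obtain t where t: "\<not> t \<le> q" "t * v \<le> prod_list rs"
    using Cons.IH[of v] Cons.prems(1) uv by auto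
  have "s * t * c \<le> s * t * (u * v)" using uv(5) by (rule mult_left_mono_lattice)
  also have "\<dots> = (s * u) * (t * v)" by (simp add: ac_simps)
  also have "\<dots> \<le> r * prod_list rs" using s(2) t(2) by (rule mult_mono_lattice)
  finally have "s * t * c \<le> prod_list (r # rs)" by simp
  moreover have "\<not> s * t \<le> q" using s(1) t(1) l_prime_mult[OF q(1)] by blast
  ultimately show ?case by blast
qed

lemma radical_factorial_l_prime_maximal:
  fixes p :: "'a::{c_lattice_domain, principally_generated}"
  assumes rf: "\<And>x::'a. product_of_l_radicals x" and p: "l_prime p" "p \<noteq> bot"
  shows "maximal_element p"
proof (rule ccontr)
  assume nm: "\<not> maximal_element p"
  obtain m where m: "maximal_element m" "p \<le> m"
    using maximal_element_above[of p] p(1) unfolding l_prime_def by blast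
  then have "\<not> m \<le> p" using nm by auto
  then obtain y where y: "l_invertible y" "y \<le> m" "\<not> y \<le> p" by (rule l_invertible_below)
  obtain q where q: "l_prime q" "sup p y \<le> q"
    and qmin: "\<And>p'. l_prime p' \<Longrightarrow> sup p y \<le> p' \<Longrightarrow> p' \<le> q \<Longrightarrow> p' = q"
    using minimal_l_prime_below[OF maximal_element_is_l_prime[OF m(1)], of "sup p y"] m(2) y(2)
    by (metis le_supI)
  have pq: "p \<le> q" and yq: "y \<le> q" using q(2) by auto
  have resp: "residual p y = p"
  proof (rule antisym[OF _ le_residual])
    show "residual p y \<le> p"
      using residual_mult_le[of p y] l_prime_mult[OF p(1)] y(3) by blast
  qed
  show False
  proof (cases "q \<le> q * q")
    case True
    obtain rs where rs: "\<forall>r\<in>set rs. l_radical r" "sup p (y * y) = prod_list rs"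
      using rf[of "sup p (y * y)"] unfolding product_of_l_radicals_def by blast
    \<comment> \<open>A radical factor above \<open>p\<close> and \<open>y * y\<close> is above
      \<open>y\<close> too, so \<open>q\<close> is also minimal over each factor that lies below
      it.\<close>
    have loc: "\<exists>s. \<not> s \<le> q \<and> s * c \<le> r"
      if r: "r \<in> set rs" and c: "compact_element c" "c \<le> q" for r c
    proof (cases "r \<le> q")
      case False
      then show ?thesis using mult_le_left by blast
    next
      case True
      have "sup p (y * y) \<le> r" using rs(2) prod_list_le_member[OF r] by simp
      moreover have "y \<le> r"
        using calculation rs(1) r l_radical_power_le[of r y 2] by (simp add: power2_eq_square)
      ultimately have py: "sup p y \<le> r" by simp
      then show ?thesis
        using minimal_l_prime_l_radical[OF q(1) True _ _ c] qmin rs(1) r order_trans[OF py] by blast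
    qed
    obtain s where s: "\<not> s \<le> q" "s * y \<le> sup p (y * y)"
      using idempotent_l_prime_prod_list[OF q(1) True loc l_invertible_compact[OF y(1)] yq] rs(2)
      by auto
    \<comment> \<open>Join principality cancels \<open>y\<close> modulo \<open>p\<close>, and
      \<open>resp\<close> keeps the right-hand side below \<open>q\<close>.\<close>
    then have "s \<le> sup y (residual p y)" by - (rule l_invertible_join[OF y(1)], simp add: sup.commute)
    also have "\<dots> \<le> q" using resp pq yq by simp
    finally have "s \<le> q" .
    then show False using s(1) by blast
  next
    case False
    then obtain z where z: "l_invertible z" "z \<le> q" "\<not> z \<le> q * q" by (rule l_invertible_below)
    \<comment> \<open>That is, \<open>z\<close> generates \<open>q\<close> locally. Since
      \<open>z\<close> is not below \<open>q * q\<close>, only one factor of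
      \<open>sup z (w * w)\<close> is below \<open>q\<close>.\<close>
    have loc: "\<exists>s. \<not> s \<le> q \<and> s * w \<le> z" if w: "l_invertible w" "w \<le> q" for w
    proof -
      obtain rs where rs: "\<forall>r\<in>set rs. l_radical r" "sup z (w * w) = prod_list rs"
        using rf[of "sup z (w * w)"] unfolding product_of_l_radicals_def by blast
      have "prod_list rs \<le> q" using rs(2) z(2) w(2) by (metis le_supI mult_le_left_trans)
      moreover have "\<not> prod_list rs \<le> q * q" using rs(2) z(3) by (metis le_sup_iff)
      ultimately obtain r s where r: "r \<in> set rs" and s: "\<not> s \<le> q" "prod_list rs = s * r"
        using prod_list_le_l_prime_cases[OF q(1)] by blast
      have "w ^ 2 \<le> r"
        using rs(2) prod_list_le_member[OF r] by (metis le_sup_iff power2_eq_square)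
      then have "w \<le> r" using rs(1) r l_radical_power_le by blast
      then have "s * w \<le> sup (w * w) z"
        using rs(2) s(2) mult_left_mono_lattice by (metis sup.commute)
      then have "s \<le> sup w (residual z w)" by (rule l_invertible_join[OF w(1)])
      then have "\<not> residual z w \<le> q" using s(1) w(2) by (meson le_supI order_trans)
      then show ?thesis using residual_mult_le by blast
    qed
    have zp: "\<not> z \<le> p"
    proof
      assume "z \<le> p"
      moreover obtain s where "\<not> s \<le> q" "s * y \<le> z" using loc[OF y(1) yq] by blast
      ultimately show False using l_prime_mult[OF p(1)] y(3) pq order_trans by meson
    qed
    obtain x where x: "l_invertible x" "l_radical x" "x \<le> p"
      using l_prime_above_l_invertible_l_radical[OF _ p] rf by blast
    \<comment> \<open>Local division by \<open>z\<close>. As \<open>z\<close> is not below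
      \<open>p\<close>, the quotient is again an invertible element below \<open>p\<close>, so the
      division can be repeated.\<close>
    have split: "\<exists>s w'. l_invertible s \<and> \<not> s \<le> q \<and> l_invertible w' \<and> w' \<le> p \<and> s * w = z * w'"
      if w: "l_invertible w" "w \<le> p" for w
    proof -
      obtain t where t: "\<not> t \<le> q" "t * w \<le> z" using loc[of w] w pq order_trans by blast
      obtain s where s: "l_invertible s" "s \<le> t" "\<not> s \<le> q" using l_invertible_below[OF t(1)] by blast
      have "s * w \<le> z" using mult_mono_lattice[OF s(2) order_refl] t(2) by (rule order_trans)
      then obtain w' where w': "s * w = z * w'" using l_invertible_dvd[OF z(1)] by blast
      have "z * w' \<le> p" using w' w(2) by (metis mult_le_right_trans)
      then have "w' \<le> p" using zp l_prime_mult[OF p(1)] by blast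
      moreover have "l_invertible w'"
        using l_invertible_mult[OF s(1) w(1)] w' l_invertible_factor_right by metis
      ultimately show ?thesis using s w' by blast
    qed
    obtain s x' where s: "l_invertible s" "\<not> s \<le> q" "l_invertible x'" "x' \<le> p" "s * x = z * x'"
      using split[OF x(1,3)] by blast
    obtain t x'' where t: "\<not> t \<le> q" "t * x' = z * x''" using split[OF s(3,4)] by blast
    have eq: "s * t * x = z * (z * x'')"
      by (metis mult.assoc mult.commute s(5) t(2))
    \<comment> \<open>Radicality of \<open>x\<close> gives \<open>z * x'' \<le> x\<close>. Inserting
      this into \<open>eq\<close> and cancelling \<open>x\<close> leaves
      \<open>s * t \<le> z\<close>.\<close>
    have "(z * x'') ^ 2 \<le> z * (z * x'')"
      unfolding power2_eq_square by (intro mult_mono_lattice mult_le_left order_refl)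
    also have "\<dots> \<le> x" unfolding eq[symmetric] by (rule mult_le_right)
    finally have "z * x'' \<le> x" using l_radical_power_le[OF x(2)] by blast
    then have "x * (s * t) \<le> x * z"
      using mult_left_mono_lattice[of "z * x''" x z] eq by (simp add: ac_simps)
    then have "s * t \<le> z" by (rule l_invertible_mult_le_cancel[OF x(1)])
    then have "s * t \<le> q" using z(2) by (rule order_trans)
    then show False using s(2) t(1) l_prime_mult[OF q(1)] by blast
  qed
qed

section \<open>Lattices whose nonzero primes are maximal\<close>

text \<open>A prime between the nonzero \<open>a\<close> and \<open>m\<close> is nonzero, hence
  maximal, hence equal to \<open>m\<close>. So \<open>m\<close> is minimal over \<open>a\<close>,
  and the results on minimal primes apply.\<close>

lemma one_dim_localization:
  fixes m :: "'a::c_lattice"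
  assumes dim: "\<And>p::'a. p \<noteq> bot \<Longrightarrow> l_prime p \<Longrightarrow> maximal_element p"
    and "l_prime m" "a \<noteq> bot" "a \<le> m" "compact_element c" "c \<le> m"
  shows one_dim_power_le: "\<exists>s n. \<not> s \<le> m \<and> s * c ^ n \<le> a"
    and one_dim_l_radical: "l_radical a \<Longrightarrow> \<exists>s. \<not> s \<le> m \<and> s * c \<le> a"
proof -
  have min: "p = m" if "l_prime p" "a \<le> p" "p \<le> m" for p
    using dim[of p] maximal_element_l_prime_eq[of p m] assms(2,3) that bot_unique by blast
  show "\<exists>s n. \<not> s \<le> m \<and> s * c ^ n \<le> a"
    using minimal_l_prime_power_le[OF assms(2,4) min assms(5,6)] by blast
  show "\<exists>s. \<not> s \<le> m \<and> s * c \<le> a" if "l_radical a"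
    using minimal_l_prime_l_radical[OF assms(2,4) min that assms(5,6)] by blast
qed

text \<open>At a maximal element \<open>m\<close> above \<open>d\<close>, the compact elements below
  \<open>m\<close> are locally below \<open>x\<close> already, hence below \<open>d\<close>.\<close>

lemma one_dim_l_radical_above:
  fixes x :: "'a::c_lattice"
  assumes dim: "\<And>p::'a. p \<noteq> bot \<Longrightarrow> l_prime p \<Longrightarrow> maximal_element p"
    and x: "l_radical x" "x \<noteq> bot" "x \<le> d"
  shows "l_radical d"
proof (rule l_radicalI)
  fix q n assume q: "compact_element q" "q ^ n \<le> d"
  show "q \<le> d"
  proof (rule le_by_localization)
    fix m :: 'a assume "maximal_element m"
    then have m: "l_prime m" by (rule maximal_element_is_l_prime)
    show "\<exists>s. \<not> s \<le> m \<and> s * q \<le> d"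
    proof (cases "d \<le> m")
      case True
      then have "q \<le> m" "x \<le> m" using q(2) x(3) l_prime_power_le[OF m] order_trans by blast+
      then show ?thesis
        using one_dim_l_radical[OF dim m x(2) _ q(1) _ x(1)] x(3) order_trans by blast
    next
      case False
      then show ?thesis using mult_le_left by blast
    qed
  qed
qed

text \<open>The element \<open>x\<close> generates \<open>m\<close> locally. If \<open>c\<close> and
  \<open>d\<close> are both below \<open>m\<close>, each is locally \<open>x\<close> times an
  invertible element, and dividing by \<open>x\<close> lowers the exponent \<open>n\<close>. An
  element not below \<open>m\<close> is locally \<open>1\<close> and serves as \<open>t\<close>
  itself.\<close>

lemma locally_comparable_induct:
  fixes m :: "'a::{c_lattice_domain, principally_generated}"
  assumes dim: "\<And>p::'a. p \<noteq> bot \<Longrightarrow> l_prime p \<Longrightarrow> maximal_element p"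
    and m: "l_prime m" and x: "l_invertible x" "l_radical x" "x \<le> m"
    and "l_invertible c" "l_invertible d" "\<not> s \<le> m" "s * x ^ n \<le> c"
  shows "\<exists>t. \<not> t \<le> m \<and> (t * c \<le> d \<or> t * d \<le> c)"
  using assms(6-)
proof (induction n arbitrary: c d s)
  case 0
  then have "\<not> c \<le> m" using order_trans by auto
  then show ?case using mult_le_left by blast
next
  case (Suc n)
  show ?case
  proof (cases "c \<le> m \<and> d \<le> m")
    case False
    then show ?thesis using mult_le_left by blast
  next
    case True
    have dvd: "\<exists>u e'. \<not> u \<le> m \<and> l_invertible e' \<and> u * e = x * e'" if e: "l_invertible e" "e \<le> m" for e
    proof -
      obtain t where t: "\<not> t \<le> m" "t * e \<le> x"
        using one_dim_l_radical[OF dim m l_invertible_neq_bot[OF x(1)] x(3)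
            l_invertible_compact[OF e(1)] e(2) x(2)] by blast
      obtain u where u: "l_invertible u" "u \<le> t" "\<not> u \<le> m" using l_invertible_below[OF t(1)] by blast
      have "u * e \<le> x" using mult_mono_lattice[OF u(2) order_refl] t(2) by (rule order_trans)
      then obtain e' where e': "u * e = x * e'" using l_invertible_dvd[OF x(1)] by blast
      have "l_invertible e'"
        using l_invertible_mult[OF u(1) e(1)] e' l_invertible_factor_right by metis
      then show ?thesis using u(3) e' by blast
    qed
    obtain u c' where u: "\<not> u \<le> m" "l_invertible c'" "u * c = x * c'" using dvd Suc.prems(1) True by blast
    obtain v d' where v: "\<not> v \<le> m" "l_invertible d'" "v * d = x * d'" using dvd Suc.prems(2) True by blast
    have "x * (u * s * x ^ n) = u * (s * x ^ Suc n)" by (simp add: ac_simps)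
    also have "\<dots> \<le> x * c'" unfolding u(3)[symmetric] by (rule mult_left_mono_lattice[OF Suc.prems(4)])
    finally have le: "u * s * x ^ n \<le> c'" by (rule l_invertible_mult_le_cancel[OF x(1)])
    have "\<not> u * s \<le> m" using u(1) Suc.prems(3) l_prime_mult[OF m] by blast
    then obtain t where t: "\<not> t \<le> m" "t * c' \<le> d' \<or> t * d' \<le> c'"
      using Suc.IH[OF u(2) v(2) _ le] by blast
    have "\<not> t * u \<le> m" "\<not> t * v \<le> m" using t(1) u(1) v(1) l_prime_mult[OF m] by blast+
    moreover have "t * u * c \<le> d" if "t * c' \<le> d'"
    proof -
      have "t * u * c = x * (t * c')" using u(3) by (metis mult.assoc mult.commute)
      also have "\<dots> \<le> v * d" unfolding v(3) by (rule mult_left_mono_lattice[OF that])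
      also have "\<dots> \<le> d" by (rule mult_le_right)
      finally show ?thesis .
    qed
    moreover have "t * v * d \<le> c" if "t * d' \<le> c'"
    proof -
      have "t * v * d = x * (t * d')" using v(3) by (metis mult.assoc mult.commute)
      also have "\<dots> \<le> u * c" unfolding u(3) by (rule mult_left_mono_lattice[OF that])
      also have "\<dots> \<le> c" by (rule mult_le_right)
      finally show ?thesis .
    qed
    ultimately show ?thesis using t(2) by blast
  qed
qed

lemma locally_comparable:
  fixes m :: "'a::{c_lattice_domain, principally_generated}"
  assumes dim: "\<And>p::'a. p \<noteq> bot \<Longrightarrow> l_prime p \<Longrightarrow> maximal_element p"
    and ex: "\<And>p::'a. p \<noteq> bot \<Longrightarrow> l_prime p \<Longrightarrow> \<exists>x. l_invertible x \<and> l_radical x \<and> x \<le> p"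
    and m: "l_prime m" and c: "l_invertible c" and d: "l_invertible d"
  shows "\<exists>t. \<not> t \<le> m \<and> (t * c \<le> d \<or> t * d \<le> c)"
proof (cases "c \<le> m")
  case False
  then show ?thesis using mult_le_left by blast
next
  case True
  have nb: "c \<noteq> bot" using c by (rule l_invertible_neq_bot)
  then have "m \<noteq> bot" using True bot_unique by blast
  then obtain x where x: "l_invertible x" "l_radical x" "x \<le> m" using ex m by blast
  obtain s n where "\<not> s \<le> m" "s * x ^ n \<le> c"
    using one_dim_power_le[OF dim m nb True l_invertible_compact[OF x(1)] x(3)] by blast
  then show ?thesis using locally_comparable_induct[OF dim m x c d] by blast
qed

text \<open>Locally the join is \<open>c\<close> or \<open>d\<close>, so it divides \<open>c\<close>
  locally, hence globally. A factor of the invertible \<open>c\<close> is invertible.\<close>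

lemma l_invertible_sup:
  fixes c d :: "'a::{c_lattice_domain, principally_generated}"
  assumes dim: "\<And>p::'a. p \<noteq> bot \<Longrightarrow> l_prime p \<Longrightarrow> maximal_element p"
    and ex: "\<And>p::'a. p \<noteq> bot \<Longrightarrow> l_prime p \<Longrightarrow> \<exists>x. l_invertible x \<and> l_radical x \<and> x \<le> p"
    and c: "l_invertible c" and d: "l_invertible d"
  shows "l_invertible (sup c d)"
proof -
  let ?a = "sup c d"
  have "c \<le> ?a * residual c ?a"
  proof (rule le_by_localization)
    fix m :: 'a assume "maximal_element m"
    then have m: "l_prime m" by (rule maximal_element_is_l_prime)
    obtain t where t: "\<not> t \<le> m" "t * c \<le> d \<or> t * d \<le> c"
      using locally_comparable[OF dim ex m c d] by blast
    have "t * c \<le> ?a * residual c ?a"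
    proof (cases "t * d \<le> c")
      case True
      then have "t \<le> residual c ?a"
        by (simp add: le_residual_iff mult_sup_distrib mult_le_right)
      then have "c * t \<le> ?a * residual c ?a" by (intro mult_mono_lattice) auto
      then show ?thesis by (simp add: mult.commute)
    next
      case False
      then obtain w where w: "t * c = d * w" using t(2) l_invertible_dvd[OF d] by blast
      have "d * w \<le> c" using w by (metis mult_le_right)
      then have "w \<le> residual c ?a"
        by (simp add: le_residual_iff mult_sup_distrib mult_le_right mult.commute[of w d])
      then show ?thesis unfolding w by (intro mult_mono_lattice) auto
    qed
    then show "\<exists>s. \<not> s \<le> m \<and> s * c \<le> ?a * residual c ?a" using t(1) by blast
  qed
  moreover have "?a * residual c ?a \<le> c" by (metis mult.commute residual_mult_le)
  ultimately have "?a * residual c ?a = c" by simp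
  then show ?thesis using c l_invertible_factor by metis
qed

text \<open>
  The factors \<open>s\<close> for which \<open>s * radical a\<close> is squeezed under a compact element below \<open>radical a\<close>
  generate \<open>1\<close>, hence finitely many of them do.
\<close>

lemma compact_radical:
  fixes a :: "'a::c_lattice"
  assumes dim: "\<And>p::'a. p \<noteq> bot \<Longrightarrow> l_prime p \<Longrightarrow> maximal_element p"
    and ex: "\<And>p::'a. p \<noteq> bot \<Longrightarrow> l_prime p \<Longrightarrow> \<exists>x. l_invertible x \<and> l_radical x \<and> x \<le> p"
    and a: "compact_element a" "a \<noteq> bot"
  shows "compact_element (radical a)"
proof -
  define S where
    "S = {s. \<exists>b. compact_element b \<and> radical a * s \<le> b \<and> b \<le> radical a}"
  have "Sup S = 1"
  proof (rule ccontr)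
    assume "Sup S \<noteq> 1"
    then obtain m where m: "maximal_element m" "Sup S \<le> m" by (rule maximal_element_above)
    have pm: "l_prime m" using m(1) by (rule maximal_element_is_l_prime)
    have "\<exists>s\<in>S. \<not> s \<le> m"
    proof (cases "a \<le> m")
      case False
      have "a \<in> S" unfolding S_def using a(1) le_radical mult_le_right by blast
      then show ?thesis using False by blast
    next
      case True
      then have "m \<noteq> bot" using a(2) bot_unique by blast
      then obtain x where x: "l_invertible x" "l_radical x" "x \<le> m" using ex pm by blast
      obtain t n where t: "\<not> t \<le> m" "t * x ^ n \<le> a"
        using one_dim_power_le[OF dim pm a(2) True l_invertible_compact[OF x(1)] x(3)] by blast
      obtain s where s: "compact_element s" "s \<le> t" "\<not> s \<le> m" using compact_below[OF t(1)] by blast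
      \<comment> \<open>The aim is \<open>s * x \<le> radical a\<close>, so that \<open>s\<close>
        carries the compact element \<open>sup a x\<close> below \<open>radical a\<close>.\<close>
      have "(s * x) ^ Suc n \<le> t * x ^ n"
        unfolding power_mult_distrib using s(2)
        by (intro mult_mono_lattice) (auto intro: mult_le_left_trans mult_le_right)
      also have "\<dots> \<le> a" by (rule t(2))
      also have "\<dots> \<le> radical a" by (rule le_radical)
      finally have "(s * x) ^ Suc n \<le> radical a" .
      then have sx: "s * x \<le> radical a" using l_radical_power_le[OF l_radical_radical] by blast
      \<comment> \<open>Being above the nonzero radical \<open>x\<close>, \<open>d\<close> is
        radical, so it is above \<open>radical a\<close>. The compact element witnessing membership
        of \<open>s\<close> in \<open>S\<close> is \<open>s * d\<close>.\<close>
      define d where "d = sup a x"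
      have "l_radical d"
        by (rule one_dim_l_radical_above[OF dim x(2) l_invertible_neq_bot[OF x(1)]]) (auto simp: d_def)
      then have "radical a \<le> d" using radical_mono[of a d] by (simp add: l_radical_def d_def)
      then have "radical a * s \<le> s * d" by (metis mult.commute mult_left_mono_lattice)
      moreover have "s * d \<le> radical a"
        using sx by (simp add: d_def mult_sup_distrib mult_le_right_trans[OF le_radical])
      moreover have "compact_element (s * d)"
        unfolding d_def by (intro compact_mult compact_sup s(1) a(1) l_invertible_compact[OF x(1)])
      ultimately have "s \<in> S" unfolding S_def by blast
      then show ?thesis using s(3) by blast
    qed
    then show False using m(2) Sup_upper order_trans by blast
  qed
  then have "1 \<le> Sup S" by simp
  then obtain F where F: "finite F" "F \<subseteq> S" "1 \<le> Sup F"
    using compact_one unfolding compact_element_def by blast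
  have "\<forall>s\<in>S. \<exists>b. compact_element b \<and> radical a * s \<le> b \<and> b \<le> radical a"
    by (simp add: S_def)
  then obtain b where b: "\<forall>s\<in>S. compact_element (b s) \<and> radical a * s \<le> b s \<and> b s \<le> radical a"
    by (rule bchoice[THEN exE])
  have "radical a = radical a * Sup F" using F(3) one_le_iff by (metis mult_1_right)
  also have "\<dots> = (SUP s\<in>F. radical a * s)" by (rule mult_Sup_distrib)
  also have "\<dots> \<le> (SUP s\<in>F. b s)" using b F(2) by (intro SUP_mono) blast
  finally have "radical a \<le> (SUP s\<in>F. b s)" .
  moreover have "(SUP s\<in>F. b s) \<le> radical a" using b F(2) by (intro SUP_least) blast
  moreover have "compact_element (SUP s\<in>F. b s)" using b F(1,2) by (intro compact_Sup) blast+
  ultimately show ?thesis by (metis antisym)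
qed

section \<open>Sorted factorizations\<close>

text \<open>The complementary factor left after splitting off the radical. In the locale below, the
  two factors multiply to \<open>c\<close> for nonzero compact \<open>c\<close>.\<close>

definition radical_quotient :: "'a::multiplicative_lattice \<Rightarrow> 'a" where
  "radical_quotient c = residual c (radical c)"

lemma le_radical_quotient: "(c::'a::multiplicative_lattice) \<le> radical_quotient c"
  by (simp add: radical_quotient_def le_residual)

locale compact_invertible_lattice =
  fixes L :: "'a::{c_lattice_domain, principally_generated} itself"
  assumes dim: "\<And>p::'a. p \<noteq> bot \<Longrightarrow> l_prime p \<Longrightarrow> maximal_element p"
    and inv: "\<And>x::'a. x \<noteq> bot \<Longrightarrow> compact_element x \<Longrightarrow> l_invertible x"
    and rad: "\<And>x::'a. compact_element x \<Longrightarrow> compact_element (radical x)"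
begin

lemma l_invertible_radical:
  assumes "compact_element (c::'a)" "c \<noteq> bot"
  shows "l_invertible (radical c)"
  using inv[OF _ rad[OF assms(1)]] assms(2) le_radical[of c] bot_unique by metis

lemma radical_mult_radical_quotient:
  assumes "compact_element (c::'a)" "c \<noteq> bot"
  shows "radical c * radical_quotient c = c"
proof -
  have "meet_principal (radical c)"
    using l_invertible_radical[OF assms] by (simp add: l_invertible_def l_principal_def)
  from meet_principal_residual_mult[OF this le_radical] show ?thesis
    by (simp add: radical_quotient_def mult.commute)
qed

lemma radical_quotient_neq_bot: "(c::'a) \<noteq> bot \<Longrightarrow> radical_quotient c \<noteq> bot"
  using le_radical_quotient[of c] bot_unique by metis

lemma compact_radical_quotient:
  assumes "compact_element (c::'a)" "c \<noteq> bot"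
  shows "compact_element (radical_quotient c)"
proof -
  have "l_invertible (radical c * radical_quotient c)"
    using radical_mult_radical_quotient[OF assms] inv[OF assms(2,1)] by simp
  then show ?thesis by (rule l_invertible_compact[OF l_invertible_factor_right])
qed

lemma radical_localization:
  assumes "l_prime m" "(c::'a) \<noteq> bot" "c \<le> m" "compact_element e" "e \<le> m"
  shows "\<exists>s. \<not> s \<le> m \<and> s * e \<le> radical c"
proof (rule one_dim_l_radical[OF dim assms(1) _ _ assms(4,5) l_radical_radical])
  show "radical c \<noteq> bot" using assms(2) le_radical[of c] bot_unique by metis
  show "radical c \<le> m" using l_prime_radical_le_iff[OF assms(1)] assms(3) by blast
qed

text \<open>At a maximal element above \<open>d\<close>, the radicals of \<open>c\<close> and
  \<open>d\<close> agree locally, so \<open>c \<le> d\<close> can be divided by them. Elsewhere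
  \<open>d\<close>, and with it \<open>radical_quotient d\<close>, is locally
  \<open>1\<close>.\<close>

lemma radical_quotient_mono:
  assumes c: "compact_element (c::'a)" "c \<noteq> bot" and d: "compact_element d" "c \<le> d"
  shows "radical_quotient c \<le> radical_quotient d"
proof (rule le_by_localization)
  fix m :: 'a assume "maximal_element m"
  then have m: "l_prime m" by (rule maximal_element_is_l_prime)
  show "\<exists>s. \<not> s \<le> m \<and> s * radical_quotient c \<le> radical_quotient d"
  proof (cases "d \<le> m")
    case False
    then show ?thesis using mult_le_left_trans[OF le_radical_quotient] by blast
  next
    case True
    then have "c \<le> m" "radical d \<le> m" using d(2) l_prime_radical_le_iff[OF m] order_trans by blast+
    then obtain s where s: "\<not> s \<le> m" "s * radical d \<le> radical c"
      using radical_localization[OF m c(2) _ rad[OF d(1)]] by blast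
    have "s * radical_quotient c * radical d \<le> radical c * radical_quotient c"
      using mult_mono_lattice[OF s(2) order_refl, of "radical_quotient c"] by (simp add: ac_simps)
    also have "\<dots> \<le> d" using radical_mult_radical_quotient[OF c] d(2) by simp
    finally have "s * radical_quotient c \<le> radical_quotient d"
      unfolding radical_quotient_def[of d] le_residual_iff .
    then show ?thesis using s(1) by blast
  qed
qed

section \<open>Extension from compact elements to all elements\<close>

text \<open>By \<open>radical_quotient_mono\<close> this join is directed when \<open>y\<close> is
  nonzero, so a compact element below it lies below a single quotient.\<close>

definition cofactor :: "'a \<Rightarrow> 'a" where
  "cofactor y = Sup {radical_quotient c | c. compact_element c \<and> c \<noteq> bot \<and> c \<le> y}"

lemma radical_quotient_le_cofactor:
  "compact_element c \<Longrightarrow> c \<noteq> bot \<Longrightarrow> c \<le> y \<Longrightarrow> radical_quotient c \<le> cofactor y"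
  unfolding cofactor_def by (rule Sup_upper) blast

lemma radical_mult_cofactor:
  assumes "y \<noteq> bot"
  shows "radical y * cofactor y = y"
proof (rule antisym; rule le_by_compact)
  fix e assume e: "compact_element e" "e \<le> y"
  show "e \<le> radical y * cofactor y"
  proof (cases "e = bot")
    case False
    have "e = radical e * radical_quotient e" using radical_mult_radical_quotient[OF e(1) False] by simp
    also have "\<dots> \<le> radical y * cofactor y"
      using radical_mono[OF e(2)] radical_quotient_le_cofactor[OF e(1) False e(2)]
      by (rule mult_mono_lattice)
    finally show ?thesis .
  qed simp
next
  fix e assume e: "compact_element e" "e \<le> radical y * cofactor y"
  let ?D = "{radical_quotient c | c. compact_element c \<and> c \<noteq> bot \<and> c \<le> y}"
  obtain u v where uv: "compact_element u" "compact_element v" "u \<le> radical y" "v \<le> cofactor y"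
    "e \<le> u * v" using compact_le_mult[OF e] by blast
  have ne: "?D \<noteq> {}" using compact_below[of y bot] assms bot_unique by blast
  have dir: "\<exists>z\<in>?D. sup x1 x2 \<le> z" if x: "x1 \<in> ?D" "x2 \<in> ?D" for x1 x2
  proof -
    obtain c1 c2 where c: "x1 = radical_quotient c1" "x2 = radical_quotient c2"
      "compact_element c1" "compact_element c2" "c1 \<noteq> bot" "c2 \<noteq> bot" "c1 \<le> y" "c2 \<le> y"
      using x by blast
    have "compact_element (sup c1 c2)" "sup c1 c2 \<noteq> bot" "sup c1 c2 \<le> y"
      using c by (auto intro: compact_sup)
    moreover from this have "sup x1 x2 \<le> radical_quotient (sup c1 c2)"
      using c by (auto intro: radical_quotient_mono)
    ultimately show ?thesis by blast
  qed
  obtain w where w: "w \<in> ?D" "v \<le> w"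
    by (rule compact_le_Sup_directed[OF uv(2) uv(4)[unfolded cofactor_def] ne dir])
  then obtain c where c: "compact_element c" "c \<noteq> bot" "c \<le> y" "v \<le> radical_quotient c" by blast
  obtain n where n: "n \<ge> 1" "u ^ n \<le> y" using uv(3) compact_le_radical_iff[OF uv(1)] by blast
  \<comment> \<open>One compact element below \<open>y\<close> serves both factors: the power of
    \<open>u\<close> puts \<open>u\<close> below its radical, and \<open>c\<close> puts
    \<open>v\<close> below its quotient.\<close>
  let ?d = "sup c (u ^ n)"
  have d: "compact_element ?d" "?d \<noteq> bot" using c(1,2) uv(1) by (auto intro: compact_sup compact_power)
  have "u ^ n \<le> ?d" by simp
  then have "u \<le> radical ?d" using n(1) compact_le_radical_iff[OF uv(1)] by blast
  moreover have "v \<le> radical_quotient ?d"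
    using c(4) radical_quotient_mono[OF c(1,2) d(1)] by (meson order_trans sup.cobounded1)
  ultimately have "u * v \<le> ?d" using radical_mult_radical_quotient[OF d] mult_mono_lattice by metis
  then have "e \<le> ?d" using uv(5) by (rule order_trans[rotated])
  then show "e \<le> y" using c(3) n(2) by (meson le_supI order_trans)
qed

text \<open>The list is \<open>radical y\<close> followed by the list for \<open>cofactor y\<close>,
  for which \<open>radical_quotient c\<close> is the compact witness with smaller exponent. The
  bound \<open>radical y \<le> r\<close> is carried along to obtain sortedness.\<close>

lemma sorted_factorization_induct:
  assumes "compact_element (c::'a)" "c \<noteq> bot" "c \<le> y" "radical c ^ n \<le> c"
  shows "\<exists>xs. (\<forall>r\<in>set xs. l_radical r \<and> radical y \<le> r) \<and> sorted_wrt (\<le>) xs \<and> y = prod_list xs"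
  using assms
proof (induction n arbitrary: c y)
  case 0
  then have "y = 1" by (metis one_le_iff order_trans power_0)
  then show ?case by (intro exI[of _ "[]"]) simp
next
  case (Suc n)
  note c = Suc.prems(1,2)
  let ?c = "radical_quotient c"
  have "radical c * radical c ^ n \<le> radical c * ?c"
    using Suc.prems(4) radical_mult_radical_quotient[OF c] by simp
  then have le: "radical c ^ n \<le> ?c" by (rule l_invertible_mult_le_cancel[OF l_invertible_radical[OF c]])
  have c': "compact_element ?c" "?c \<noteq> bot"
    using compact_radical_quotient[OF c] radical_quotient_neq_bot[OF c(2)] .
  \<comment> \<open>The exponent bound is transferred from \<open>radical c\<close> to
    \<open>radical ?c\<close>: at a maximal element above \<open>?c\<close> the two agree
    locally.\<close>
  have "radical ?c ^ n \<le> ?c"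
  proof (rule le_by_localization)
    fix m :: 'a assume "maximal_element m"
    then have m: "l_prime m" by (rule maximal_element_is_l_prime)
    show "\<exists>s. \<not> s \<le> m \<and> s * radical ?c ^ n \<le> ?c"
    proof (cases "?c \<le> m")
      case False
      then show ?thesis using mult_le_left by blast
    next
      case True
      then have "c \<le> m" "radical ?c \<le> m"
        using le_radical_quotient l_prime_radical_le_iff[OF m] order_trans by blast+
      then obtain s where s: "\<not> s \<le> m" "s * radical ?c \<le> radical c"
        using radical_localization[OF m c(2) _ rad[OF c'(1)]] by blast
      have "s ^ n * radical ?c ^ n \<le> radical c ^ n"
        using power_mono_lattice[OF s(2)] by (simp add: power_mult_distrib)
      then have "s ^ n * radical ?c ^ n \<le> ?c" using le by (rule order_trans)
      moreover have "\<not> s ^ n \<le> m" using s(1) l_prime_power_le[OF m] by blast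
      ultimately show ?thesis by blast
    qed
  qed
  then obtain xs where xs: "\<forall>r\<in>set xs. l_radical r \<and> radical (cofactor y) \<le> r"
    "sorted_wrt (\<le>) xs" "cofactor y = prod_list xs"
    using Suc.IH[OF c' radical_quotient_le_cofactor[OF c Suc.prems(3)]] by blast
  have "y \<noteq> bot" using c(2) Suc.prems(3) bot_unique by blast
  then have y: "radical y * cofactor y = y" by (rule radical_mult_cofactor)
  then have "radical y \<le> radical (cofactor y)" by (metis mult_le_right radical_mono)
  then have "\<forall>r\<in>set xs. l_radical r \<and> radical y \<le> r" using xs(1) order_trans by blast
  then show ?case
    using xs(2,3) y l_radical_radical by (intro exI[of _ "radical y # xs"]) auto
qed

lemma sorted_factorization:
  "\<exists>xs. (\<forall>r\<in>set xs. l_radical r) \<and> sorted_wrt (\<le>) xs \<and> (y::'a) = prod_list xs"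
proof (cases "y = bot")
  case True
  then show ?thesis by (intro exI[of _ "[bot]"]) (simp add: l_radical_bot)
next
  case False
  then obtain c where c: "compact_element c" "c \<le> y" "c \<noteq> bot"
    using compact_below[of y bot] bot_unique by metis
  obtain n where "radical c ^ n \<le> c"
    using compact_le_radical_iff[OF rad[OF c(1)], of c] by blast
  then show ?thesis using sorted_factorization_induct[OF c(1,3,2)] by blast
qed

end

section \<open>The equivalences\<close>

text \<open>With \<open>p\<close> strictly below the maximal \<open>m\<close>, a radical invertible
  \<open>x \<le> p\<close> acquires a square divisor \<open>z'\<close> below \<open>m\<close>:
  \<open>z\<close> divides \<open>x\<close> with cofactor \<open>w\<close>, and \<open>z'\<close>
  divides both. Radicality of \<open>x\<close> forces \<open>z' = 1\<close>.\<close>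

lemma l_invertible_radical_l_prime_maximal:
  fixes p :: "'a::{c_lattice_domain, principally_generated}"
  assumes inv: "\<And>x::'a. x \<noteq> bot \<Longrightarrow> compact_element x \<Longrightarrow> l_invertible (radical x)"
    and p: "l_prime p" "p \<noteq> bot"
  shows "maximal_element p"
proof (rule ccontr)
  assume nm: "\<not> maximal_element p"
  obtain m where m: "maximal_element m" "p \<le> m"
    using maximal_element_above[of p] p(1) unfolding l_prime_def by blast
  have pm: "l_prime m" using m(1) by (rule maximal_element_is_l_prime)
  have "\<not> m \<le> p" using nm m by auto
  then obtain y where y: "compact_element y" "y \<le> m" "\<not> y \<le> p" by (rule compact_below)
  obtain a where a: "compact_element a" "a \<le> p" "a \<noteq> bot"
    using compact_below[of p bot] p(2) bot_unique by metis
  define x where "x = radical a"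
  have x: "l_invertible x" "l_radical x" "x \<le> p"
    unfolding x_def using inv[OF a(3,1)] l_radical_radical l_prime_radical_le_iff[OF p(1)] a(2)
    by auto
  define z where "z = radical (sup x y)"
  have nb: "sup x y \<noteq> bot" using l_invertible_neq_bot[OF x(1)] by simp
  have z: "l_invertible z"
    unfolding z_def by (intro inv compact_sup l_invertible_compact[OF x(1)] nb y(1))
  have xyz: "sup x y \<le> z" unfolding z_def by (rule le_radical)
  have zm: "z \<le> m"
    unfolding z_def l_prime_radical_le_iff[OF pm] using x(3) m(2) y(2) by (meson le_supI order_trans)
  have zp: "\<not> z \<le> p" using xyz y(3) by (meson le_sup_iff order_trans)
  obtain w where w: "x = z * w" using l_invertible_dvd[OF z] xyz by auto
  have wp: "w \<le> p" using w x(3) zp l_prime_mult[OF p(1)] by blast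
  have wi: "l_invertible w" using x(1) w l_invertible_factor_right by metis
  define z' where "z' = radical (sup z w)"
  have z': "l_invertible z'"
    unfolding z'_def using l_invertible_neq_bot[OF z] wi z
    by (intro inv compact_sup l_invertible_compact) auto
  have zwz': "sup z w \<le> z'" unfolding z'_def by (rule le_radical)
  have z'm: "z' \<le> m"
    unfolding z'_def l_prime_radical_le_iff[OF pm] using zm wp m(2) by (meson le_supI order_trans)
  obtain u v where uv: "z = z' * u" "w = z' * v"
    using l_invertible_dvd[OF z'] zwz' by (meson le_sup_iff)
  have eq: "x = z' * (z' * (u * v))" using w uv by (simp add: ac_simps)
  have "(z' * (u * v)) ^ 2 \<le> x"
    unfolding eq power2_eq_square by (intro mult_mono_lattice mult_le_left order_refl)
  then have "z' * (u * v) \<le> x" by (rule l_radical_power_le[OF x(2)])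
  then have "z' * (u * v) * 1 \<le> z' * (u * v) * z'" using eq by (simp add: ac_simps)
  moreover have "l_invertible (z' * (u * v))" using x(1) eq l_invertible_factor_right by metis
  ultimately have "1 \<le> z'" using l_invertible_mult_le_cancel by blast
  then show False using z'm pm by (metis l_prime_def one_le_iff order_trans)
qed

text \<open>Since \<open>bot\<close> is prime, distinct nonzero primes \<open>p \<le> q\<close> give
  a chain with three members. Conversely, a chain of primes keeps at most one member after removal
  of \<open>bot\<close>.\<close>

lemma lattice_dim_le_one_iff:
  "lattice_dim (L :: 'a::multiplicative_lattice_domain itself) \<le> 1 \<longleftrightarrow>
    (\<forall>p q::'a. p \<noteq> bot \<longrightarrow> l_prime p \<longrightarrow> l_prime q \<longrightarrow> p \<le> q \<longrightarrow> p = q)"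
  (is "?dim \<longleftrightarrow> ?max")
proof
  assume ?dim
  show ?max
  proof (intro allI impI)
    fix p q :: 'a assume pq: "p \<noteq> bot" "l_prime p" "l_prime q" "p \<le> q"
    show "p = q"
    proof (rule ccontr)
      assume "p \<noteq> q"
      moreover have "q \<noteq> bot" using pq(1,4) bot_unique[of p] by metis
      ultimately have card: "card {bot, p, q} = 3" using pq(1) by simp
      have "Complete_Partial_Order.chain (\<le>) {bot, p, q}"
        using pq(4) by (auto simp: Complete_Partial_Order.chain_def)
      then have "enat (3 - 1) \<le> lattice_dim L"
        unfolding lattice_dim_def card[symmetric] using pq(2,3) l_prime_bot
        by (intro SUP_upper) auto
      also note \<open>?dim\<close>
      finally show False by (simp add: one_enat_def)
    qed
  qed
next
  assume max: ?max
  show ?dim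
    unfolding lattice_dim_def
  proof (rule SUP_least)
    fix C :: "'a set"
    assume "C \<in> {C. finite C \<and> C \<noteq> {} \<and> (\<forall>p\<in>C. l_prime p) \<and> Complete_Partial_Order.chain (\<le>) C}"
    then have C: "finite C" "\<And>p. p \<in> C \<Longrightarrow> l_prime p"
      "\<And>p q. p \<in> C \<Longrightarrow> q \<in> C \<Longrightarrow> p \<le> q \<or> q \<le> p"
      by (auto simp: Complete_Partial_Order.chain_def)
    have "p = q" if "p \<in> C - {bot}" "q \<in> C - {bot}" for p q
      using that max C(2) C(3)[of p q] by auto
    then have "card (C - {bot}) \<le> 1" by (auto simp: card_le_Suc0_iff_eq C(1))
    then have "card C - 1 \<le> 1"
      using card_Diff1_le[of C bot] diff_card_le_card_Diff[of "{bot}" C] by simp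
    then show "enat (card C - 1) \<le> 1" by (simp add: one_enat_def)
  qed
qed

theorem theorem4p6:
  fixes L :: "'a::{c_lattice_domain, principally_generated} itself"
  shows
    "(radical_factorial L \<longleftrightarrow>
        lattice_dim L \<le> 1 \<and> (\<forall>x::'a. l_invertible x \<longrightarrow> product_of_l_radicals x))
   \<and> (radical_factorial L \<longleftrightarrow>
        (\<forall>p::'a. p \<noteq> bot \<and> l_prime p \<longrightarrow>
           maximal_element p \<and> (\<exists>x. l_invertible x \<and> l_radical x \<and> x \<le> p)))
   \<and> (radical_factorial L \<longleftrightarrow>
        (\<forall>x::'a. \<exists>xs. (\<forall>y\<in>set xs. l_radical y) \<and> sorted_wrt (\<le>) xs \<and> x = prod_list xs))
   \<and> (radical_factorial L \<longleftrightarrow>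
        (\<forall>x::'a. x \<noteq> bot \<and> compact_element x \<longrightarrow> l_invertible (radical x)))
   \<and> (radical_factorial L \<longleftrightarrow>
        (\<forall>x::'a. x \<noteq> bot \<and> compact_element x \<longrightarrow> l_invertible x) \<and>
        (\<forall>x::'a. compact_element x \<longrightarrow> compact_element (radical x)))"
  (is "(?c1 \<longleftrightarrow> ?c2a \<and> ?c2b) \<and> (_ \<longleftrightarrow> ?c3) \<and> (_ \<longleftrightarrow> ?c4) \<and> (_ \<longleftrightarrow> ?c5) \<and> (_ \<longleftrightarrow> ?c6a \<and> ?c6b)")
proof -
  \<comment> \<open>The hub is \<open>?c3\<close>: it follows from \<open>?c1\<close>, closes a
    cycle through \<open>?c6a \<and> ?c6b\<close> and \<open>?c5\<close>, and returns to
    \<open>?c1\<close> through \<open>?c4\<close>. Of the second condition, \<open>?c2a\<close>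
    comes from \<open>?c3\<close> and \<open>?c2b\<close> from \<open>?c1\<close>.\<close>
  have c13: ?c3 if ?c1
  proof -
    have rf: "product_of_l_radicals x" for x :: 'a using \<open>?c1\<close> by (simp add: radical_factorial_def)
    show ?thesis
      using radical_factorial_l_prime_maximal[OF rf] l_prime_above_l_invertible_l_radical[OF rf] by metis
  qed
  have c36: "?c6a \<and> ?c6b" if ?c3
  proof -
    have dim: "maximal_element p" and ex: "\<exists>x. l_invertible x \<and> l_radical x \<and> x \<le> p"
      if "p \<noteq> bot" "l_prime p" for p :: 'a
      using \<open>?c3\<close> that by blast+
    have ?c6a
      using compact_l_invertibleI l_invertible_sup[OF dim ex] by blast
    moreover have "compact_element (radical x)" if "compact_element x" for x :: 'a
      using compact_radical[OF dim ex that] l_radical_bot compact_bot by (metis l_radical_def)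
    ultimately show ?thesis by blast
  qed
  have c65: ?c5 if "?c6a \<and> ?c6b"
    using that le_radical bot_unique by metis
  have c53: ?c3 if ?c5
  proof (intro allI impI conjI)
    fix p :: 'a assume p: "p \<noteq> bot \<and> l_prime p"
    show "maximal_element p"
      using l_invertible_radical_l_prime_maximal[of p] \<open>?c5\<close> p by blast
    obtain c where c: "compact_element c" "c \<le> p" "c \<noteq> bot"
      using compact_below[of p bot] p bot_unique by metis
    then show "\<exists>x. l_invertible x \<and> l_radical x \<and> x \<le> p"
      using \<open>?c5\<close> p l_radical_radical l_prime_radical_le_iff by blast
  qed
  have c34: ?c4 if ?c3
  proof -
    interpret compact_invertible_lattice L
      using \<open>?c3\<close> c36[OF \<open>?c3\<close>] by unfold_locales blast+
    show ?thesis using sorted_factorization by blast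
  qed
  have c41: ?c1 if ?c4
    using that unfolding radical_factorial_def product_of_l_radicals_def by blast
  have c32: ?c2a if ?c3
    using that maximal_element_l_prime_eq unfolding lattice_dim_le_one_iff by metis
  have c23: ?c3 if "?c2a \<and> ?c2b"
  proof (intro allI impI conjI)
    fix p :: 'a assume p: "p \<noteq> bot \<and> l_prime p"
    obtain m where "maximal_element m" "p \<le> m"
      using maximal_element_above[of p] p unfolding l_prime_def by blast
    then show "maximal_element p"
      using that p maximal_element_is_l_prime unfolding lattice_dim_le_one_iff by metis
    show "\<exists>x. l_invertible x \<and> l_radical x \<and> x \<le> p"
      using l_prime_above_l_invertible_l_radical[of p] that p by metis
  qed
  have c1b: ?c2b if ?c1 using that by (simp add: radical_factorial_def)
  show ?thesis using c13 c36 c65 c53 c34 c41 c32 c23 c1b by argo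
qed

end
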